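(* Let $$\Phi(u)=\sum_{n=1}^{\infty}\left(4\pi^2 n^4 e^{\frac{9}{2}u}-6\pi n^2 e^{\frac{5}{2}u}\right)\exp\!\left(-\pi n^2 e^{2u}\right),$$ and for real $\lambda$ define the entire function $$\Xi^{(-1)}_{\lambda}(z):=2\int_0^\infty e^{\lambda u^2}\Phi(u)\,\frac{\sin zu}{u}\,du .$$ Then: (1) For each real $\lambda$, $\lim_{t\to\infty,\ t\in\mathbb{R}}\Xi^{(-1)}_{\lambda}(t)=A_0$, where $A_0:=\pi\Phi(0)\approx 2.80668$ is a nonzero constant independent of $\lambda$; moreover $A_0=\frac{\pi}{2}\left(4\theta''(1)+6\theta'(1)\right)$, where $\theta(x)=\sum_{n\in\mathbb{Z}}e^{-\pi n^2 x}$. (2) For each real $\lambda$, the function $\Xi^{(-1)}_{\lambda}(t)$ has only finitely many zeros on the real axis and has infinitely many non-real zeros. Its real zeros always include $t=0$, and for $\lambda\le 0$, $t=0$ is its only real zero.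
   Context: $\Phi(u)$ is the function appearing in Riemann's Fourier integral representation $\xi(\tfrac12+iz)=2\int_0^\infty\Phi(u)\cos(zu)\,du$, where $\xi(s)=\tfrac12 s(s-1)\pi^{-s/2}\Gamma(s/2)\zeta(s)$ is the Riemann $\xi$-function. Zeros are counted in $\mathbb{C}$. *)

theory Defs
  imports "HOL-Complex_Analysis.Complex_Analysis"
begin

(* The series over n >= 1, indexed here by n = Suc k. *)
definition Phi :: "real \<Rightarrow> real" where
  "Phi u = (\<Sum>k. (4 * pi^2 * real (Suc k)^4 * exp (9 / 2 * u)
                   - 6 * pi * real (Suc k)^2 * exp (5 / 2 * u))
                  * exp (- pi * real (Suc k)^2 * exp (2 * u)))"

(* The domain of integration omits the null set {0}, where sin (z u) / u is not
   literally defined. *)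
definition Xi_m1 :: "real \<Rightarrow> complex \<Rightarrow> complex" where
  "Xi_m1 lam z = 2 * (LINT u:{0<..}|lborel.
      of_real (exp (lam * u^2) * Phi u) * (sin (z * of_real u) / of_real u))"

definition A0 :: real where
  "A0 = pi * Phi 0"

(* Only meaningful for x > 0, where the sum converges. *)
definition theta :: "real \<Rightarrow> real" where
  "theta x = (\<Sum>\<^sub>\<infinity>n\<in>(UNIV :: int set). exp (- pi * (of_int n)^2 * x))"

end

(*
  Put g(u) = exp(lam u^2) Phi(u), so that Xi(z) = 2 int_0^oo g(u) sin(zu)/u du.

  Integration by parts gives int_0^oo g(u) sin(tu)/u du = - int_0^oo g'(u) Si(tu) du, and dominated
  convergence with Si(x) -> pi/2 yields the limit (pi/2) g(0). Since Xi is odd, it stays away from 0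
  near both ends of the real axis, which leaves only finitely many real zeros.

  Since g decays faster than any Gaussian, |Xi(z)| <= C exp(2 |z|^2). With finitely many zeros,
  Xi = p exp(Q) with p a polynomial and, by Borel-Caratheodory, deg Q <= 2. But then Xi(t) Xi(-t)
  tends to 0 or to infinity along the real axis, since p(0) = 0, whereas it should tend to -A0^2.

  For lam <= 0 the function g(u)/u is decreasing, which makes int_0^oo (g(u)/u) sin(tu) du positive
  for t > 0.
*)
theory Submission
  imports Defs "HOL-Probability.Sinc_Integral" "HOL-Real_Asymp.Real_Asymp"
begin

text \<open>Term-by-term differentiation is done once, for the moments sum n^(2j) exp(-pi n^2 x):
  the x-derivative of a moment is -pi times the next one. Hence \<open>Phi\<close>, its derivative,
  \<open>theta\<close> and the first two derivatives of \<open>theta\<close> are all combinations of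
  moments, and a sign claim about \<open>Phi\<close> reduces to an inequality for each n.

  The sign argument rests on g(u)/u rather than on g itself. A termwise proof that
  \<open>Phi\<close> decreases would break down: the term n = 1 of Phi' is positive at u = 0,
  because 30 pi - 8 pi^2 - 15 is slightly positive. The inequality u Phi'(u) < Phi(u) leaves enough
  room to hold for every single term.

  One majorant, |g(u)| |z| exp(|z| u), serves twice: it bounds Xi by a multiple of exp(2 |z|^2), and
  it dominates the partial sums of the sine series, whose termwise integration shows that Xi is
  entire.

  The product Xi(t) Xi(-t) cancels the linear term of Q, so only the sign of the real part of the
  quadratic coefficient has to be discussed.\<close>

section \<open>Moments of the theta series; \<open>Phi\<close> and \<open>theta\<close> in terms of
  them\<close>

definition theta_moment :: "nat \<Rightarrow> real \<Rightarrow> real" where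
  "theta_moment j x = (\<Sum>k. real (Suc k) ^ (2 * j) * exp (- pi * real (Suc k)^2 * x))"

lemma summable_theta_moment:
  assumes "x > 0"
  shows "summable (\<lambda>k. real (Suc k) ^ m * exp (- pi * real (Suc k)^2 * x))"
proof (rule summable_comparison_test_bigo)
  define c where "c = pi * x"
  have "c > 0"
    using assms unfolding c_def by simp
  then have "(\<lambda>k. real (Suc k) ^ m * exp (- c * real (Suc k)^2)) \<in> O(\<lambda>k. 1 / real (Suc k)^2)"
    by real_asymp
  then show "(\<lambda>k. real (Suc k) ^ m * exp (- pi * real (Suc k)^2 * x)) \<in> O(\<lambda>k. 1 / real (Suc k)^2)"
    unfolding c_def by (simp add: mult_ac)
  have "summable (\<lambda>k. 1 / real (Suc k)^2)"
    using inverse_power_summable[of 2, where 'a=real] summable_Suc_iff[of "\<lambda>k. 1 / real k ^2"]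
    by (simp add: field_simps)
  then show "summable (\<lambda>k. norm (1 / real (Suc k)^2))"
    by simp
qed

lemma theta_moment_has_real_derivative:
  assumes "x > 0"
  shows "(theta_moment j has_real_derivative - pi * theta_moment (Suc j) x) (at x)"
proof -
  \<comment> \<open>The derivative series does not converge uniformly on all of (0, oo). To the
    right of x/2 each term is bounded by its value at x/2, which gives the Weierstrass
    majorant.\<close>
  define S where "S = {x/2<..}"
  let ?f = "\<lambda>k x. real (Suc k) ^ (2 * j) * exp (- pi * real (Suc k)^2 * x)"
  let ?f' = "\<lambda>k x. - pi * (real (Suc k) ^ (2 * Suc j) * exp (- pi * real (Suc k)^2 * x))"
  have "((\<lambda>x. \<Sum>k. ?f k x) has_field_derivative (\<Sum>k. ?f' k x)) (at x)"
  proof (rule has_field_derivative_series'(2)[where S = S and ?x0.0 = x])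
    show "convex S"
      unfolding S_def by simp
    show "(?f k has_real_derivative ?f' k y) (at y within S)" if "y \<in> S" for k y
      by (rule derivative_eq_intros refl)+ (simp add: power2_eq_square algebra_simps)
    show "uniformly_convergent_on S (\<lambda>n x. \<Sum>k<n. ?f' k x)"
    proof (rule Weierstrass_m_test'[where M = "\<lambda>k. pi * (real (Suc k) ^ (2 * Suc j) * exp (- pi * real (Suc k)^2 * (x/2)))"])
      show "norm (?f' n y) \<le> pi * (real (Suc n) ^ (2 * Suc j) * exp (- pi * real (Suc n)^2 * (x/2)))"
        if "y \<in> S" for n y
      proof -
        have "exp (- pi * real (Suc n)^2 * y) \<le> exp (- pi * real (Suc n)^2 * (x/2))"
          using that unfolding S_def by (intro exp_mono mult_left_mono_neg) auto
        then show ?thesis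
          by (simp add: abs_mult del: power_Suc of_nat_Suc mult_Suc_right)
      qed
      show "summable (\<lambda>k. pi * (real (Suc k) ^ (2 * Suc j) * exp (- pi * real (Suc k)^2 * (x/2))))"
        by (rule summable_mult[OF summable_theta_moment]) (use assms in simp)
    qed
    show "x \<in> S" "x \<in> interior S"
      using assms unfolding S_def by (auto simp: interior_open)
    show "summable (\<lambda>k. ?f k x)"
      using assms by (rule summable_theta_moment)
  qed
  moreover have "(\<Sum>k. ?f' k x) = - pi * theta_moment (Suc j) x"
    unfolding theta_moment_def using assms
    by (intro suminf_mult summable_theta_moment)
  ultimately show ?thesis
    unfolding theta_moment_def[abs_def] by simp
qed

lemma continuous_on_theta_moment [continuous_intros]:
  assumes "continuous_on S f" "\<And>u. u \<in> S \<Longrightarrow> f u > 0"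
  shows "continuous_on S (\<lambda>u. theta_moment j (f u))"
proof (rule continuous_on_compose2[where t = "{0<..}" and g = "theta_moment j" and f = f])
  show "continuous_on {0<..} (theta_moment j)"
    by (rule continuous_at_imp_continuous_on) (auto intro: DERIV_isCont[OF theta_moment_has_real_derivative])
qed (use assms in auto)

lemma theta_moment_nonneg: "x > 0 \<Longrightarrow> theta_moment j x \<ge> 0"
  unfolding theta_moment_def by (intro suminf_nonneg summable_theta_moment) auto

text \<open>Since n^2 >= 1, passing from 1 to x costs every term at least the factor exp(-pi (x -
  1)).\<close>

lemma theta_moment_le:
  assumes "x \<ge> 1"
  shows "theta_moment j x \<le> theta_moment j 1 * exp pi * exp (- pi * x)"
proof -
  have "theta_moment j x \<le> (\<Sum>k. exp (- pi * (x - 1)) * (real (Suc k) ^ (2 * j) * exp (- pi * real (Suc k)^2 * 1)))"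
    unfolding theta_moment_def
  proof (intro suminf_le summable_mult summable_theta_moment)
    fix k
    have "1 * (x - 1) \<le> real (Suc k)^2 * (x - 1)"
      using assms by (intro mult_right_mono) auto
    then have "pi * (x - 1) \<le> pi * (real (Suc k)^2 * (x - 1))"
      by simp
    then have "exp (- pi * real (Suc k)^2 * x) \<le> exp (- pi * (x - 1) + - pi * real (Suc k)^2 * 1)"
      by (intro exp_mono) (simp add: algebra_simps)
    then have "real (Suc k) ^ (2 * j) * exp (- pi * real (Suc k)^2 * x)
      \<le> real (Suc k) ^ (2 * j) * exp (- pi * (x - 1) + - pi * real (Suc k)^2 * 1)"
      by (intro mult_left_mono) auto
    then show "real (Suc k) ^ (2 * j) * exp (- pi * real (Suc k)^2 * x)
      \<le> exp (- pi * (x - 1)) * (real (Suc k) ^ (2 * j) * exp (- pi * real (Suc k)^2 * 1))"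
      by (simp only: exp_add mult_ac)
  qed (use assms in auto)
  also have "\<dots> = exp (- pi * (x - 1)) * theta_moment j 1"
    unfolding theta_moment_def by (intro suminf_mult summable_theta_moment) auto
  also have "\<dots> = theta_moment j 1 * exp pi * exp (- pi * x)"
    by (simp add: algebra_simps exp_diff exp_minus divide_simps)
  finally show ?thesis .
qed

lemma Phi_conv_theta_moment:
  "Phi u = 4 * pi^2 * exp (9 / 2 * u) * theta_moment 2 (exp (2 * u))
         - 6 * pi * exp (5 / 2 * u) * theta_moment 1 (exp (2 * u))"
proof -
  have "Phi u = (\<Sum>k. 4 * pi^2 * exp (9 / 2 * u) * (real (Suc k) ^ (2 * 2) * exp (- pi * real (Suc k)^2 * exp (2 * u)))
     - 6 * pi * exp (5 / 2 * u) * (real (Suc k) ^ (2 * 1) * exp (- pi * real (Suc k)^2 * exp (2 * u))))"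
    unfolding Phi_def by (intro suminf_cong) (simp add: algebra_simps power2_eq_square del: of_nat_Suc)
  also have "\<dots> = 4 * pi^2 * exp (9 / 2 * u) * theta_moment 2 (exp (2 * u))
         - 6 * pi * exp (5 / 2 * u) * theta_moment 1 (exp (2 * u))"
    unfolding theta_moment_def suminf_mult[OF summable_theta_moment[OF exp_gt_zero], symmetric]
    by (intro suminf_diff[symmetric] summable_mult summable_theta_moment exp_gt_zero)
  finally show ?thesis .
qed

lemma theta_conv_theta_moment:
  assumes "x > 0"
  shows "theta x = 1 + 2 * theta_moment 0 x"
proof -
  let ?f = "\<lambda>n::int. exp (- pi * (of_int n)^2 * x)"
  have "((\<lambda>k. exp (- pi * real (Suc k)^2 * x)) has_sum theta_moment 0 x) UNIV"
    using summable_sums[OF summable_theta_moment[OF assms, of 0]] unfolding theta_moment_def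
    by (intro sums_nonneg_imp_has_sum) auto
  then have "((\<lambda>k. ?f (int (Suc k))) has_sum theta_moment 0 x) UNIV"
    by simp
  moreover have "bij_betw (\<lambda>k. int (Suc k)) UNIV {0<..}"
    by (rule bij_betwI[where g = "\<lambda>n. nat n - 1"]) auto
  ultimately have pos: "(?f has_sum theta_moment 0 x) {0<..}"
    using has_sum_reindex_bij_betw by blast
  then have "((\<lambda>n. ?f (- n)) has_sum theta_moment 0 x) {0<..}"
    by simp
  moreover have "bij_betw uminus {0<..} {..<0::int}"
    by (rule bij_betwI[where g = uminus]) auto
  ultimately have neg: "(?f has_sum theta_moment 0 x) {..<0}"
    using has_sum_reindex_bij_betw[of uminus "{0<..}" "{..<0::int}" ?f] by blast
  have "(?f has_sum (theta_moment 0 x + theta_moment 0 x)) ({0<..} \<union> {..<0})"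
    by (intro has_sum_Un_disjoint pos neg) auto
  then have "(?f has_sum (?f 0 + (theta_moment 0 x + theta_moment 0 x))) (insert 0 ({0<..} \<union> {..<0}))"
    by (intro has_sum_insert) auto
  moreover have "insert 0 ({0<..} \<union> {..<0}) = (UNIV :: int set)"
    by auto
  ultimately show ?thesis
    unfolding theta_def by (auto dest!: infsumI)
qed

lemma deriv_theta:
  assumes "x > 0"
  shows "deriv theta x = - 2 * pi * theta_moment 1 x"
proof -
  have "((\<lambda>x. 1 + 2 * theta_moment 0 x) has_real_derivative - 2 * pi * theta_moment 1 x) (at x)"
    using theta_moment_has_real_derivative[OF assms, of 0]
    by (auto intro!: derivative_eq_intros)
  then have "(theta has_real_derivative - 2 * pi * theta_moment 1 x) (at x)"
    by (rule has_field_derivative_transform_within_open[of _ _ _ "{0<..}"])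
       (use assms theta_conv_theta_moment in auto)
  then show ?thesis
    by (rule DERIV_imp_deriv)
qed

lemma deriv_deriv_theta:
  assumes "x > 0"
  shows "deriv (deriv theta) x = 2 * pi^2 * theta_moment 2 x"
proof -
  have "((\<lambda>x. - 2 * pi * theta_moment 1 x) has_real_derivative 2 * pi^2 * theta_moment 2 x) (at x)"
    using theta_moment_has_real_derivative[OF assms, of 1]
    by (auto intro!: derivative_eq_intros simp: power2_eq_square numeral_2_eq_2)
  then have "(deriv theta has_real_derivative 2 * pi^2 * theta_moment 2 x) (at x)"
    by (rule has_field_derivative_transform_within_open[of _ _ _ "{0<..}"])
       (use assms deriv_theta in auto)
  then show ?thesis
    by (rule DERIV_imp_deriv)
qed

text \<open>At u = 0 the exponential factors are 1. With M_j the moment at 1, \<open>Phi 0\<close>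
  is 4 pi^2 M_2 - 6 pi M_1, while theta''(1) = 2 pi^2 M_2 and theta'(1) = -2 pi M_1.\<close>

lemma A0_conv_theta: "A0 = pi / 2 * (4 * deriv (deriv theta) 1 + 6 * deriv theta 1)"
  by (simp add: A0_def Phi_conv_theta_moment deriv_theta deriv_deriv_theta algebra_simps)

section \<open>Entire functions with finitely many zeros and quadratic exponential growth\<close>

text \<open>The map v -> v / (2A - v) fixes 0 and sends the half-plane Re v < A into the unit disc.
  The Schwarz lemma at radius R/2 therefore gives 2 |f| <= |2A - f| <= 2A + |f|.\<close>

lemma Borel_Caratheodory:
  assumes holf: "f holomorphic_on ball 0 R" and f0: "f 0 = 0" and "A > 0" "R > 0"
    and bound: "\<And>z. norm z < R \<Longrightarrow> Re (f z) < A"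
    and z: "norm z \<le> R / 2"
  shows "norm (f z) \<le> 2 * A"
proof -
  define h where "h w = f (of_real R * w) / (2 * of_real A - f (of_real R * w))" for w
  have in_ball: "norm (of_real R * w) < R" if "norm w < 1" for w :: complex
    using that \<open>R > 0\<close> by (simp add: norm_mult)
  have Re_pos: "Re (2 * of_real A - f (of_real R * w)) > 0" if "norm w < 1" for w
    using bound[OF in_ball[OF that]] \<open>A > 0\<close> by simp
  have nz: "2 * of_real A - f (of_real R * w) \<noteq> 0" if "norm w < 1" for w
    using Re_pos[OF that] by (metis less_irrefl zero_complex.sel(1))
  have "h holomorphic_on ball 0 1"
    unfolding h_def using in_ball nz
    by (intro holomorphic_intros holomorphic_on_compose_gen[OF _ holf, unfolded o_def]) auto
  moreover have "h 0 = 0"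
    by (simp add: h_def f0)
  moreover have "norm (h w) < 1" if "norm w < 1" for w
  proof -
    let ?v = "f (of_real R * w)"
    have "Re ?v < A"
      using bound in_ball that by blast
    \<comment> \<open>The two squared moduli below differ by 4 A (A - Re v).\<close>
    then have "A * Re ?v < A * A"
      using \<open>A > 0\<close> by simp
    then have "(norm ?v)\<^sup>2 < (norm (2 * of_real A - ?v))\<^sup>2"
      unfolding cmod_power2 by (simp add: power2_eq_square algebra_simps)
    then have "norm ?v < norm (2 * of_real A - ?v)"
      by (simp add: power2_less_imp_less)
    then show ?thesis
      unfolding h_def norm_divide using nz[OF that] by (simp add: divide_less_eq_1)
  qed
  moreover have z': "norm (z / of_real R) \<le> 1 / 2"
    using z \<open>R > 0\<close> by (simp add: norm_divide field_simps)
  ultimately have "norm (h (z / of_real R)) \<le> norm (z / of_real R)"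
    by (intro Schwarz_Lemma) auto
  also note z'
  finally have "norm (f z / (2 * of_real A - f z)) \<le> 1 / 2"
    unfolding h_def using \<open>R > 0\<close> by simp
  moreover have "2 * of_real A - f z \<noteq> 0"
    using nz[of "z / of_real R"] z' \<open>R > 0\<close> by simp
  ultimately have "2 * norm (f z) \<le> norm (2 * of_real A - f z)"
    by (simp add: norm_divide divide_simps)
  also have "\<dots> \<le> norm (2 * of_real A :: complex) + norm (f z)"
    by (rule norm_triangle_ineq4)
  finally show ?thesis
    using \<open>A > 0\<close> by (simp add: norm_mult)
qed

lemma entire_nonvanishing_quadratic_growth:
  fixes g :: "complex \<Rightarrow> complex"
  assumes holg: "g holomorphic_on UNIV" and nz: "\<And>z. g z \<noteq> 0"
    and growth: "\<And>z. norm (g z) \<le> exp (C + B * (norm z)^2)" and "B \<ge> 0"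
  obtains a b c where "\<And>z. g z = exp (a + b * z + c * z^2)"
proof -
  have "\<exists>l. l holomorphic_on UNIV \<and> (\<forall>z\<in>UNIV. g z = exp (l z))"
    using simply_connected_eq_holomorphic_log[OF open_UNIV] convex_imp_simply_connected[OF convex_UNIV]
      holg nz by blast
  then obtain l where holl: "l holomorphic_on UNIV" and l: "\<And>z. g z = exp (l z)"
    by auto
  define Q where "Q z = l z - l 0" for z
  have holQ: "Q holomorphic_on UNIV"
    unfolding Q_def by (intro holomorphic_intros holl)
  \<comment> \<open>The summand 1 makes \<open>K\<close> positive and the bound on
    \<open>Re (Q z)\<close> strict, as \<open>Borel_Caratheodory\<close> demands.\<close>
  define K where "K = \<bar>C\<bar> + \<bar>Re (l 0)\<bar> + 1"
  have "K > 0"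
    unfolding K_def by simp
  have Re_Q: "Re (Q z) < K + B * (norm z)^2" for z
  proof -
    have "Re (l z) \<le> C + B * (norm z)^2"
      using growth[of z] unfolding l by simp
    then show ?thesis
      unfolding Q_def K_def by simp
  qed
  have Q_sum: "Q z = (\<Sum>k\<le>2. (deriv ^^ k) Q 0 / fact k * z ^ k)" for z
  proof (rule Liouville_polynomial[OF holQ, of 1 "2 * (K + 4 * B)"])
    fix z :: complex
    assume z: "1 \<le> norm z"
    have z2: "1 \<le> (norm z)\<^sup>2"
      using z by simp
    \<comment> \<open>A disc of twice the radius |z| is used, which is where the factor 4 of
      \<open>B\<close> comes from; |z| >= 1 then lets \<open>K\<close> be absorbed into the
      quadratic term.\<close>
    have "norm (Q z) \<le> 2 * (K + B * (2 * norm z)^2)"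
    proof (rule Borel_Caratheodory[where f = Q and z = z and R = "2 * norm z"])
      show "Q holomorphic_on ball 0 (2 * norm z)"
        using holQ holomorphic_on_subset by blast
      show "0 < K + B * (2 * norm z)\<^sup>2"
        using \<open>K > 0\<close> \<open>B \<ge> 0\<close> by (simp add: add_pos_nonneg)
      show "Re (Q w) < K + B * (2 * norm z)\<^sup>2" if "norm w < 2 * norm z" for w
      proof -
        have "(norm w)\<^sup>2 \<le> (2 * norm z)\<^sup>2"
          using that by (intro power_mono) auto
        then have "B * (norm w)\<^sup>2 \<le> B * (2 * norm z)\<^sup>2"
          using \<open>B \<ge> 0\<close> by (intro mult_left_mono)
        then show ?thesis
          using Re_Q[of w] by linarith
      qed
    qed (use z in \<open>auto simp: Q_def\<close>)
    also have "\<dots> \<le> 2 * (K + 4 * B) * norm z ^ 2"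
      using z2 mult_left_mono[OF z2, of K] unfolding K_def by (simp add: power_mult_distrib algebra_simps)
    finally show "norm (Q z) \<le> 2 * (K + 4 * B) * norm z ^ 2" .
  qed
  have Q_eq: "Q z = Q 0 + deriv Q 0 * z + deriv (deriv Q) 0 / 2 * z^2" for z
    by (subst Q_sum) (simp add: numeral_2_eq_2)
  have "g z = exp ((l 0 + Q 0) + deriv Q 0 * z + deriv (deriv Q) 0 / 2 * z^2)" for z
  proof -
    have "l z = l 0 + Q z"
      unfolding Q_def by simp
    then show ?thesis
      unfolding l Q_eq[of z] by (simp only: add.assoc)
  qed
  then show ?thesis
    using that by blast
qed

text \<open>Induction on the number of distinct zeros: dividing by (z - s)^n with n the full order
  of the zero s removes s and leaves the other zeros alone.\<close>

lemma entire_finite_zeros_factorization: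
  fixes f :: "complex \<Rightarrow> complex"
  assumes "finite {z. f z = 0}" "f holomorphic_on UNIV"
  shows "\<exists>p g. p \<noteq> 0 \<and> g holomorphic_on UNIV \<and> (\<forall>z. g z \<noteq> 0) \<and> (\<forall>z. f z = poly p z * g z)"
  using assms
proof (induction "card {z. f z = 0}" arbitrary: f)
  case 0
  then have "\<And>z. f z \<noteq> 0"
    by auto
  with 0 show ?case
    by (intro exI[of _ 1] exI[of _ f]) auto
next
  case (Suc k)
  then obtain s where s: "f s = 0"
    by (metis (mono_tags, lifting) card.empty empty_Collect_eq nat.distinct(1))
  define n where "n = nat (zorder f s)"
  have "\<exists>w. f w \<noteq> 0"
  proof (rule ccontr)
    assume "\<not> (\<exists>w. f w \<noteq> 0)"
    then have "{z. f z = 0} = UNIV"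
      by auto
    then show False
      using Suc.prems(1) infinite_UNIV_char_0[where 'a = complex] by simp
  qed
  then have "\<exists>r>0. cball s r \<subseteq> UNIV \<and> zor_poly f s holomorphic_on cball s r
    \<and> (\<forall>w\<in>cball s r. f w = zor_poly f s w * (w - s) ^ n \<and> zor_poly f s w \<noteq> 0)"
    unfolding n_def
    using zorder_exist_zero[OF Suc.prems(2) open_UNIV connected_UNIV, of s] by simp
  then obtain r where r: "r > 0" "zor_poly f s holomorphic_on cball s r"
    "\<And>w. w \<in> cball s r \<Longrightarrow> f w = zor_poly f s w * (w - s) ^ n \<and> zor_poly f s w \<noteq> 0"
    by blast
  \<comment> \<open>At \<open>s\<close> the plain quotient evaluates to 0, so the value there is
    taken from the local factorization, which is nonzero. Holomorphy is glued from a ball around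
    \<open>s\<close> and the punctured plane.\<close>
  define h where "h w = (if w = s then zor_poly f s s else f w / (w - s) ^ n)" for w
  have h_eq: "h w = zor_poly f s w" if "w \<in> ball s r" for w
    using r(3)[of w] that unfolding h_def by auto
  have "zor_poly f s holomorphic_on ball s r"
    using r(2) by (rule holomorphic_on_subset) auto
  then have "h holomorphic_on ball s r"
    by (rule holomorphic_transform) (simp add: h_eq)
  moreover have "(\<lambda>w. f w / (w - s) ^ n) holomorphic_on - {s}"
    using Suc.prems(2) by (intro holomorphic_intros holomorphic_on_subset[OF Suc.prems(2)]) auto
  then have "h holomorphic_on - {s}"
    by (rule holomorphic_transform) (auto simp: h_def)
  ultimately have "h holomorphic_on (ball s r \<union> - {s})"
    by (intro holomorphic_on_Un) auto
  moreover have "ball s r \<union> - {s} = UNIV"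
    using r(1) by auto
  ultimately have holh: "h holomorphic_on UNIV"
    by simp
  have "h s \<noteq> 0"
    using h_eq[of s] r by auto
  then have zeros: "{z. h z = 0} = {z. f z = 0} - {s}"
    by (auto simp: h_def)
  then have "card {z. h z = 0} = k"
    using Suc.hyps(2) Suc.prems(1) s by simp
  moreover have "finite {z. h z = 0}"
    using Suc.prems(1) zeros by simp
  ultimately obtain p g where pg: "p \<noteq> 0" "g holomorphic_on UNIV" "\<And>z. g z \<noteq> 0" "\<And>z. h z = poly p z * g z"
    using Suc.hyps(1)[of h] holh by metis
  have f_eq: "f z = (z - s) ^ n * h z" for z
    using r(3)[of s] r(1) unfolding h_def by (cases "z = s") (auto simp: mult.commute)
  show ?case
  proof (intro exI conjI allI)
    show "[:- s, 1:] ^ n * p \<noteq> 0"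
      using pg(1) by simp
    show "f z = poly ([:- s, 1:] ^ n * p) z * g z" for z
      by (simp add: f_eq pg(4) mult.assoc)
  qed (use pg in auto)
qed

text \<open>Dividing out the polynomial preserves the growth bound up to a constant: outside a disc
  the polynomial is bounded away from 0, and on the disc the cofactor is bounded by
  compactness.\<close>

lemma entire_finite_zeros_quadratic_growth:
  fixes f :: "complex \<Rightarrow> complex"
  assumes fin: "finite {z. f z = 0}" and holf: "f holomorphic_on UNIV"
    and growth: "\<And>z. norm (f z) \<le> exp (C + B * (norm z)^2)" and "B \<ge> 0"
  obtains p a b c where "p \<noteq> 0" "\<And>z. f z = poly p z * exp (a + b * z + c * z^2)"
proof -
  obtain p g where p: "p \<noteq> 0" and holg: "g holomorphic_on UNIV"
    and g: "\<And>z. g z \<noteq> 0" and f: "\<And>z. f z = poly p z * g z"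
    using entire_finite_zeros_factorization[OF fin holf] by metis
  have "\<exists>R m. m > 0 \<and> (\<forall>z. R \<le> norm z \<longrightarrow> m \<le> norm (poly p z))"
  proof (cases "degree p = 0")
    case True
    then obtain q where "p = [:q:]"
      using degree_eq_zeroE by blast
    with p show ?thesis
      by (intro exI[of _ 0] exI[of _ "norm q"]) auto
  next
    case False
    then have "filterlim (poly p) at_infinity at_infinity"
      by (intro filterlim_poly_at_infinity) auto
    then have "eventually (\<lambda>z. norm (poly p z) \<ge> 1) at_infinity"
      unfolding filterlim_at_infinity[OF order_refl] by simp
    then show ?thesis
      unfolding eventually_at_infinity by (meson zero_less_one)
  qed
  then obtain R m where m: "m > 0" "\<And>z. R \<le> norm z \<Longrightarrow> m \<le> norm (poly p z)"
    by blast
  have "compact (g ` cball 0 R)"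
    using holg by (intro compact_continuous_image holomorphic_on_imp_continuous_on)
                  (auto intro: holomorphic_on_subset)
  then obtain M where M: "\<And>z. norm z \<le> R \<Longrightarrow> norm (g z) \<le> M"
    using compact_imp_bounded bounded_iff by (metis dist_0_norm image_eqI mem_cball)
  \<comment> \<open>Large enough for both regions: ln (max 1 M) is needed on the disc and C - ln m
    outside. The maximum with 1 keeps the logarithm meaningful.\<close>
  define D where "D = \<bar>C\<bar> + \<bar>ln m\<bar> + \<bar>ln (max 1 M)\<bar>"
  have "norm (g z) \<le> exp (D + B * (norm z)^2)" for z
  proof (cases "norm z \<le> R")
    case True
    then have "norm (g z) \<le> max 1 M"
      using M by fastforce
    also have "\<dots> = exp (ln (max 1 M))"
      by simp
    also have "\<dots> \<le> exp (D + B * (norm z)^2)"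
      unfolding D_def using \<open>B \<ge> 0\<close> by (intro exp_mono) (smt (verit) mult_nonneg_nonneg zero_le_power2)
    finally show ?thesis .
  next
    case False
    then have "m * norm (g z) \<le> norm (f z)"
      unfolding f norm_mult using m(2)[of z] by (intro mult_right_mono) auto
    also have "\<dots> \<le> exp (C + B * (norm z)^2)"
      by (rule growth)
    finally have "norm (g z) \<le> exp (C + B * (norm z)^2) / m"
      using m(1) by (simp add: field_simps)
    also have "\<dots> = exp (C + B * (norm z)^2 - ln m)"
      using m(1) by (simp add: exp_diff)
    also have "\<dots> \<le> exp (D + B * (norm z)^2)"
      unfolding D_def by (intro exp_mono) linarith
    finally show ?thesis .
  qed
  then obtain a b c where "\<And>z. g z = exp (a + b * z + c * z^2)"
    using entire_nonvanishing_quadratic_growth[OF holg g _ \<open>B \<ge> 0\<close>] by metis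
  then show ?thesis
    using that p f by metis
qed

text \<open>
  Here $f(t) f(-t) = p(t) p(-t) e^{2a + 2ct^2}$, and $p$ is not constant: this tends to
  $0$ or to infinity, depending on the sign of the real part of $c$.
\<close>
lemma infinite_zeros_if_odd_limit:
  fixes f :: "complex \<Rightarrow> complex"
  assumes holf: "f holomorphic_on UNIV" and "f 0 = 0" and odd: "\<And>z. f (- z) = - f z"
    and growth: "\<And>z. norm (f z) \<le> exp (C + B * (norm z)^2)" and "B \<ge> 0"
    and lim: "((\<lambda>t. f (of_real t)) \<longlongrightarrow> L) at_top" and "L \<noteq> 0"
  shows "infinite {z. f z = 0}"
proof
  assume fin: "finite {z. f z = 0}"
  obtain p a b c where p: "p \<noteq> 0" and f: "\<And>z. f z = poly p z * exp (a + b * z + c * z^2)"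
    using entire_finite_zeros_quadratic_growth[OF fin holf growth \<open>B \<ge> 0\<close>] by metis
  have "poly p 0 = 0"
    using f[of 0] \<open>f 0 = 0\<close> by simp
  with p have deg: "degree p > 0"
    by (metis degree_eq_zeroE neq0_conv pCons_eq_0_iff poly_pCons mult_zero_left add.right_neutral)
  \<comment> \<open>\<open>[:0, -1:]\<close> is the polynomial -X, so q(t) = p(t) p(-t), of twice
    the degree of \<open>p\<close>.\<close>
  define q where "q = p * (p \<circ>\<^sub>p [:0, -1:])"
  have "degree q > 0"
    unfolding q_def using p deg by (subst degree_mult_eq) (auto simp: pcompose_eq_0_iff degree_pcompose)
  have "(\<lambda>t. f (of_real t) * f (of_real (- t))) = (\<lambda>t. - ((f (of_real t))^2))"
    by (auto simp: odd power2_eq_square)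
  then have "((\<lambda>t. f (of_real t) * f (of_real (- t))) \<longlongrightarrow> - (L^2)) at_top"
    using lim by (auto intro!: tendsto_intros)
  then have "((\<lambda>t. norm (f (of_real t) * f (of_real (- t)))) \<longlongrightarrow> norm (- (L^2))) at_top"
    by (rule tendsto_norm)
  moreover have "norm (f (of_real t) * f (of_real (- t))) = norm (poly q (of_real t)) * exp (2 * Re a + 2 * Re c * t^2)" for t
  proof -
    have "f (of_real t) * f (of_real (- t)) =
      poly q (of_real t) * exp ((a + b * of_real t + c * (of_real t)^2) + (a - b * of_real t + c * (of_real t)^2))"
      unfolding f q_def exp_add[of "a + b * of_real t + c * (of_real t)^2"] by (simp add: poly_pcompose)
    then show ?thesis
      by (simp add: norm_mult flip: of_real_power)
  qed
  ultimately have lim2: "((\<lambda>t. norm (poly q (of_real t)) * exp (2 * Re a + 2 * Re c * t^2)) \<longlongrightarrow> norm L^2) at_top"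
    by (simp add: norm_power)
  have q_lim: "filterlim (\<lambda>t. norm (poly q (of_real t))) at_top at_top"
  proof -
    have "filterlim (poly q) at_infinity at_infinity"
      using \<open>degree q > 0\<close> by (rule filterlim_poly_at_infinity)
    moreover have "filterlim (\<lambda>t::real. of_real t :: complex) at_infinity at_top"
      by (rule filterlim_of_real_at_infinity)
    ultimately show ?thesis
      by (rule filterlim_at_infinity_imp_norm_at_top[OF filterlim_compose])
  qed
  show False
  \<comment> \<open>The borderline \<open>Re c = 0\<close> belongs to the first case: the
    exponential is then constant, and divergence comes from the positive degree of \<open>q\<close>
    alone.\<close>
  proof (cases "Re c \<ge> 0")
    case True
    have "filterlim (\<lambda>t. norm (poly q (of_real t)) * exp (2 * Re a)) at_top at_top"
      by (rule filterlim_at_top_mult_tendsto_pos[OF tendsto_const _ q_lim]) simp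
    then have "filterlim (\<lambda>t. norm (poly q (of_real t)) * exp (2 * Re a + 2 * Re c * t^2)) at_top at_top"
      by (rule filterlim_at_top_mono)
         (use True in \<open>auto intro!: always_eventually mult_left_mono\<close>)
    then show False
      using not_tendsto_and_filterlim_at_infinity[OF _ lim2 filterlim_at_top_imp_at_infinity] by simp
  next
    case False
    define d where "d = - Re c"
    have "d > 0"
      using False by (simp add: d_def)
    have "((\<lambda>t. \<Sum>i\<le>degree q. coeff q i * of_real (t ^ i * exp (2 * Re a + 2 * Re c * t^2))) \<longlongrightarrow> (\<Sum>i\<le>degree q. 0)) at_top"
    proof (intro tendsto_sum tendsto_mult_right_zero)
      fix i
      have "((\<lambda>t. t ^ i * exp (2 * Re a - 2 * d * t^2)) \<longlongrightarrow> 0) at_top"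
        using \<open>d > 0\<close> by real_asymp
      then show "((\<lambda>t. of_real (t ^ i * exp (2 * Re a + 2 * Re c * t^2)) :: complex) \<longlongrightarrow> 0) at_top"
        unfolding d_def using tendsto_of_real[of _ 0] by force
    qed
    then have "((\<lambda>t. poly q (of_real t) * of_real (exp (2 * Re a + 2 * Re c * t^2))) \<longlongrightarrow> 0) at_top"
      unfolding poly_altdef sum_distrib_right by (simp add: mult_ac)
    then have "((\<lambda>t. norm (poly q (of_real t) * of_real (exp (2 * Re a + 2 * Re c * t^2)) :: complex)) \<longlongrightarrow> 0) at_top"
      by (rule tendsto_norm_zero)
    then have "((\<lambda>t. norm (poly q (of_real t)) * exp (2 * Re a + 2 * Re c * t^2)) \<longlongrightarrow> 0) at_top"
      by (simp add: norm_mult)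
    then have "norm L^2 = 0"
      using lim2 LIM_unique trivial_limit_at_top_linorder tendsto_unique by blast
    then show False
      using \<open>L \<noteq> 0\<close> by simp
  qed
qed

section \<open>Derivative and positivity of \<open>Phi\<close>, and the decrease of Phi(u)/u\<close>

text \<open>The coefficient 30 is 18 + 12: 4 * 9/2 from the exponential in front of the second
  moment, and 6 * 2 from differentiating the first moment.\<close>

definition Phi_deriv :: "real \<Rightarrow> real" where
  "Phi_deriv u = 30 * pi^2 * exp (9 / 2 * u) * theta_moment 2 (exp (2 * u))
     - 8 * pi^3 * exp (13 / 2 * u) * theta_moment 3 (exp (2 * u))
     - 15 * pi * exp (5 / 2 * u) * theta_moment 1 (exp (2 * u))"

lemma theta_moment_exp_has_real_derivative:
  "((\<lambda>u. theta_moment j (exp (2 * u))) has_real_derivative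
    - 2 * pi * exp (2 * u) * theta_moment (Suc j) (exp (2 * u))) (at u)"
proof -
  have "((\<lambda>u. exp (2 * u)) has_real_derivative 2 * exp (2 * u)) (at u)"
    by (auto intro!: derivative_eq_intros)
  from DERIV_chain2[where f = "theta_moment j", OF theta_moment_has_real_derivative this]
  show ?thesis
    by (simp add: mult_ac)
qed

lemma Phi_has_real_derivative: "(Phi has_real_derivative Phi_deriv u) (at u)"
proof -
  have "exp (9 / 2 * u) * exp (2 * u) = exp (13 / 2 * u)" "exp (5 / 2 * u) * exp (2 * u) = exp (9 / 2 * u)"
    by (simp_all flip: exp_add)
  note E = this
  have "((\<lambda>u. 4 * pi^2 * exp (9 / 2 * u) * theta_moment 2 (exp (2 * u))
         - 6 * pi * exp (5 / 2 * u) * theta_moment 1 (exp (2 * u))) has_real_derivative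
     (18 * pi^2 * exp (9 / 2 * u) * theta_moment 2 (exp (2 * u))
       - 8 * pi^3 * (exp (9 / 2 * u) * exp (2 * u)) * theta_moment 3 (exp (2 * u)))
     - (15 * pi * exp (5 / 2 * u) * theta_moment 1 (exp (2 * u))
       - 12 * pi^2 * (exp (5 / 2 * u) * exp (2 * u)) * theta_moment 2 (exp (2 * u)))) (at u)"
    by (rule derivative_eq_intros refl theta_moment_exp_has_real_derivative)+
       (simp add: power2_eq_square power3_eq_cube algebra_simps numeral_2_eq_2 numeral_3_eq_3)
  then show ?thesis
    unfolding E Phi_conv_theta_moment[abs_def] Phi_deriv_def
    by (rule DERIV_cong) (simp add: algebra_simps)
qed

lemma continuous_on_Phi_deriv: "continuous_on S Phi_deriv"
  unfolding Phi_deriv_def[abs_def] by (intro continuous_intros) auto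

lemma continuous_on_Phi: "continuous_on S Phi"
  by (rule continuous_at_imp_continuous_on) (blast intro: DERIV_isCont Phi_has_real_derivative)

text \<open>The moments share the factor exp(-pi n^2 x), so the combination is one series whose n-th
  coefficient is a polynomial in n^2. This turns the inequalities for \<open>Phi\<close> into
  inequalities for each n.\<close>

lemma theta_moment_combination_pos:
  assumes "x > 0"
    and pos: "\<And>n. n \<ge> 1 \<Longrightarrow> a * real n ^ 6 + b * real n ^ 4 + c * real n ^ 2 > 0"
  shows "a * theta_moment 3 x + b * theta_moment 2 x + c * theta_moment 1 x > 0"
proof -
  let ?e = "\<lambda>k. exp (- pi * real (Suc k)^2 * x)"
  let ?f = "\<lambda>m k. real (Suc k) ^ m * ?e k"
  have s: "summable (?f m)" for m
    using assms(1) by (rule summable_theta_moment)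
  have "0 < (\<Sum>k. a * ?f 6 k + b * ?f 4 k + c * ?f 2 k)"
  proof (rule suminf_pos)
    show "summable (\<lambda>k. a * ?f 6 k + b * ?f 4 k + c * ?f 2 k)"
      by (rule summable_add summable_mult s)+
    fix k
    have "0 < (a * real (Suc k) ^ 6 + b * real (Suc k) ^ 4 + c * real (Suc k) ^ 2) * ?e k"
      by (intro mult_pos_pos pos) auto
    then show "0 < a * ?f 6 k + b * ?f 4 k + c * ?f 2 k"
      by (simp only: distrib_right mult.assoc)
  qed
  also have "\<dots> = a * (\<Sum>k. ?f 6 k) + b * (\<Sum>k. ?f 4 k) + c * (\<Sum>k. ?f 2 k)"
    using suminf_add[OF summable_add[OF summable_mult[OF s[of 6], of a] summable_mult[OF s[of 4], of b]] summable_mult[OF s[of 2], of c]]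
      suminf_add[OF summable_mult[OF s[of 6], of a] summable_mult[OF s[of 4], of b]]
      suminf_mult[OF s[of 6], of a] suminf_mult[OF s[of 4], of b] suminf_mult[OF s[of 2], of c]
    by linarith
  finally show ?thesis
    by (simp add: theta_moment_def)
qed

text \<open>Every term is positive: with x = pi n^2 e^(2u) it is a positive multiple of 4x^2 - 6x,
  and x >= pi > 3/2. The third moment enters with coefficient 0.\<close>

lemma Phi_pos:
  assumes "u \<ge> 0"
  shows "Phi u > 0"
proof -
  have "0 * theta_moment 3 (exp (2 * u)) + (4 * pi^2 * exp (9 / 2 * u)) * theta_moment 2 (exp (2 * u))
        + (- 6 * pi * exp (5 / 2 * u)) * theta_moment 1 (exp (2 * u)) > 0"
  proof (rule theta_moment_combination_pos)
    fix n :: nat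
    assume "n \<ge> 1"
    have "exp (5 / 2 * u) \<le> exp (9 / 2 * u)"
      using assms by simp
    then have "6 * exp (5 / 2 * u) < 4 * pi * exp (9 / 2 * u)"
      using pi_gt3 mult_strict_right_mono[OF pi_gt3, of "exp (9 / 2 * u)"] exp_gt_zero[of "9 / 2 * u"]
      by linarith
    then have "6 * exp (5 / 2 * u) * (pi * real n ^ 2) < 4 * pi * exp (9 / 2 * u) * (pi * real n ^ 2)"
      using \<open>n \<ge> 1\<close> by (intro mult_strict_right_mono) auto
    also have "\<dots> \<le> 4 * pi * exp (9 / 2 * u) * (pi * real n ^ 4)"
      using \<open>n \<ge> 1\<close> by (intro mult_left_mono power_increasing) auto
    finally show "0 * real n ^ 6 + (4 * pi^2 * exp (9 / 2 * u)) * real n ^ 4 + (- 6 * pi * exp (5 / 2 * u)) * real n ^ 2 > 0"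
      by (simp add: power2_eq_square[of pi] mult_ac)
  qed simp
  then show ?thesis
    by (simp add: Phi_conv_theta_moment)
qed

text \<open>
  With $x = \pi n^2 e^{2u}$, the $n$-th term of $\Phi(u)$ is $e^{u/2} (4x^2 - 6x) e^{-x}$ and the one
  of $\Phi'(u)$ is $e^{u/2} (30x^2 - 8x^3 - 15x) e^{-x}$. The latter is positive only for
  $x < 4$, and then $u < 1$.
\<close>
lemma Phi_deriv_less:
  assumes "u > 0"
  shows "u * Phi_deriv u < Phi u"
proof -
  have "(8 * pi^3 * exp (13 / 2 * u) * u) * theta_moment 3 (exp (2 * u))
      + (4 * pi^2 * exp (9 / 2 * u) - 30 * pi^2 * exp (9 / 2 * u) * u) * theta_moment 2 (exp (2 * u))
      + (15 * pi * exp (5 / 2 * u) * u - 6 * pi * exp (5 / 2 * u)) * theta_moment 1 (exp (2 * u)) > 0"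
  proof (rule theta_moment_combination_pos)
    fix n :: nat
    assume n: "n \<ge> 1"
    define E where "E = exp (2 * u)"
    define x where "x = pi * real n ^ 2 * E"
    have "pi * (1 + 2 * u) \<le> pi * E"
      unfolding E_def using exp_ge_add_one_self[of "2 * u"] by (intro mult_left_mono) auto
    also have "\<dots> * 1 \<le> pi * E * real n ^ 2"
      using n unfolding E_def by (intro mult_left_mono) auto
    finally have x_ge: "pi * (1 + 2 * u) \<le> x"
      unfolding x_def by (simp add: mult_ac)
    have "pi * 1 \<le> pi * (1 + 2 * u)"
      using assms by (intro mult_left_mono) auto
    moreover have pi_ge: "pi \<ge> 157 / 50"
      using pi_approx(1) by simp
    ultimately have "x \<ge> 157 / 50"
      using x_ge pi_ge by linarith
    have "(30 * x - 8 * x^2 - 15) * u < 4 * x - 6"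
    proof (cases "x \<ge> 4")
      case True
      have "4 * x \<le> x * x"
        using True by (intro mult_right_mono) auto
      then have "30 * x - 8 * x^2 - 15 \<le> 0"
        unfolding power2_eq_square using True by linarith
      then have "(30 * x - 8 * x^2 - 15) * u \<le> 0"
        using assms by (intro mult_nonpos_nonneg) auto
      then show ?thesis
        using True by linarith
    next
      case False
      have "3 * (1 + 2 * u) < pi * (1 + 2 * u)"
        using assms pi_gt3 by (intro mult_strict_right_mono) auto
      also note x_ge
      finally have "u < 1"
        using False by simp
      \<comment> \<open>Expanded and multiplied by 8, this says 8x^2 >= 29.92 x - 15.072. For x < 4
        it bounds 30x - 8x^2 - 15 by 0.08 x + 0.072 < 1.\<close>
      have "0 \<le> (x - 157 / 50) * (x - 3 / 5)"
        using \<open>x \<ge> 157 / 50\<close> by (intro mult_nonneg_nonneg) auto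
      then have "30 * x - 8 * x^2 - 15 \<le> 1"
        using False by (simp add: field_simps power2_eq_square)
      then have "(30 * x - 8 * x^2 - 15) * u \<le> 1 * u"
        using assms by (intro mult_right_mono) auto
      then show ?thesis
        using \<open>u < 1\<close> \<open>x \<ge> 157 / 50\<close> by linarith
    qed
    \<comment> \<open>The factor e^(u/2) x restores the n-th coefficient of the combination: x
      carries e^(2u), and 13/2, 9/2, 5/2 are 1/2 plus 6, 4, 2.\<close>
    then have "0 < exp (u / 2) * x * (8 * x^2 * u + (4 - 30 * u) * x + (15 * u - 6))"
      using \<open>x \<ge> 157 / 50\<close> by (intro mult_pos_pos) (auto simp: algebra_simps)
    moreover have "exp (13 / 2 * u) = exp (u / 2) * E^3" "exp (9 / 2 * u) = exp (u / 2) * E^2"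
      "exp (5 / 2 * u) = exp (u / 2) * E"
      unfolding E_def by (simp_all flip: exp_add exp_of_nat_mult)
    ultimately show "(8 * pi^3 * exp (13 / 2 * u) * u) * real n ^ 6
      + (4 * pi^2 * exp (9 / 2 * u) - 30 * pi^2 * exp (9 / 2 * u) * u) * real n ^ 4
      + (15 * pi * exp (5 / 2 * u) * u - 6 * pi * exp (5 / 2 * u)) * real n ^ 2 > 0"
      unfolding x_def by (simp add: algebra_simps power2_eq_square power3_eq_cube numeral_eq_Suc)
  qed simp
  then show ?thesis
    by (simp add: Phi_conv_theta_moment Phi_deriv_def algebra_simps)
qed

section \<open>Decay of \<open>Phi\<close> beyond every Gaussian\<close>

lemma quadratic_minus_exp_bounded_above:
  fixes a b :: real
  obtains C where "\<And>u. u \<ge> 0 \<Longrightarrow> a * u^2 + b * u - pi * exp (2 * u) \<le> C"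
proof -
  let ?h = "\<lambda>u::real. a * u^2 + b * u - pi * exp (2 * u)"
  have "filterlim ?h at_bot at_top"
    by real_asymp
  then have "eventually (\<lambda>u. ?h u \<le> 0) at_top"
    by (simp only: filterlim_at_bot)
  then obtain U where U: "\<And>u. u \<ge> U \<Longrightarrow> ?h u \<le> 0"
    by (auto simp: eventually_at_top_linorder)
  have "bounded (?h ` {0..U})"
    by (intro compact_imp_bounded compact_continuous_image continuous_intros) auto
  then obtain M where M: "\<forall>u\<in>{0..U}. \<bar>?h u\<bar> \<le> M"
    by (auto simp: bounded_iff)
  show ?thesis
  proof
    fix u :: real
    assume "u \<ge> 0"
    then have "?h u \<le> 0 \<or> \<bar>?h u\<bar> \<le> M"
      using U[of u] M by (cases "u \<le> U") auto
    then show "?h u \<le> max 0 M"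
      by linarith
  qed
qed

text \<open>The double exponential exp(-pi e^(2u)) beats exp(-R u^2) for every \<open>R\<close>, so
  \<open>R\<close> can later be chosen to absorb exp(lam u^2). The spare exp(-2u) pays for the
  factor u in the derivative of the weight and for integrability.\<close>

lemma theta_moment_exp_decay:
  obtains C where "C > 0" "\<And>u. u \<ge> 0 \<Longrightarrow> exp (b * u) * theta_moment j (exp (2 * u)) \<le> C * exp (- R * u^2 - 2 * u)"
proof -
  obtain D where D: "\<And>u. u \<ge> 0 \<Longrightarrow> R * u^2 + (b + 2) * u - pi * exp (2 * u) \<le> D"
    using quadratic_minus_exp_bounded_above[of R "b + 2"] by blast
  define K where "K = theta_moment j 1 * exp pi"
  have "K \<ge> 0"
    unfolding K_def by (simp add: theta_moment_nonneg)
  show ?thesis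
  proof
    show "(K + 1) * exp D > 0"
      using \<open>K \<ge> 0\<close> by simp
    fix u :: real
    assume u: "u \<ge> 0"
    have "exp (b * u) * theta_moment j (exp (2 * u)) \<le> exp (b * u) * (K * exp (- pi * exp (2 * u)))"
      unfolding K_def using u by (intro mult_left_mono theta_moment_le) auto
    also have "\<dots> = K * exp (b * u - pi * exp (2 * u))"
      by (simp add: exp_diff exp_minus field_simps)
    also have "\<dots> \<le> (K + 1) * exp (D + (- R * u^2 - 2 * u))"
      using D[OF u] \<open>K \<ge> 0\<close> by (intro mult_mono exp_mono) (auto simp: algebra_simps)
    also have "\<dots> = (K + 1) * exp D * exp (- R * u^2 - 2 * u)"
      by (simp only: exp_add mult.assoc)
    finally show "exp (b * u) * theta_moment j (exp (2 * u)) \<le> (K + 1) * exp D * exp (- R * u^2 - 2 * u)" .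
  qed
qed

lemma Phi_decay:
  obtains C where "C > 0" "\<And>u. u \<ge> 0 \<Longrightarrow> \<bar>Phi u\<bar> \<le> C * exp (- R * u^2 - 2 * u)"
    "\<And>u. u \<ge> 0 \<Longrightarrow> \<bar>Phi_deriv u\<bar> \<le> C * exp (- R * u^2 - 2 * u)"
proof -
  obtain C1 where C1: "C1 > 0" "\<And>u. u \<ge> 0 \<Longrightarrow> exp (5 / 2 * u) * theta_moment 1 (exp (2 * u)) \<le> C1 * exp (- R * u^2 - 2 * u)"
    using theta_moment_exp_decay by blast
  obtain C2 where C2: "C2 > 0" "\<And>u. u \<ge> 0 \<Longrightarrow> exp (9 / 2 * u) * theta_moment 2 (exp (2 * u)) \<le> C2 * exp (- R * u^2 - 2 * u)"
    using theta_moment_exp_decay by blast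
  obtain C3 where C3: "C3 > 0" "\<And>u. u \<ge> 0 \<Longrightarrow> exp (13 / 2 * u) * theta_moment 3 (exp (2 * u)) \<le> C3 * exp (- R * u^2 - 2 * u)"
    using theta_moment_exp_decay by blast
  \<comment> \<open>For each moment the larger of its absolute coefficients in \<open>Phi\<close>
    and \<open>Phi_deriv\<close>, so that one constant serves both bounds.\<close>
  let ?C = "15 * pi * C1 + 30 * pi^2 * C2 + 8 * pi^3 * C3"
  show ?thesis
  proof (rule that)
    show "?C > 0"
      using C1(1) C2(1) C3(1) by (intro add_pos_pos mult_pos_pos) auto
    fix u :: real
    assume u: "u \<ge> 0"
    define W where "W = exp (- R * u^2 - 2 * u)"
    define t1 where "t1 = exp (5 / 2 * u) * theta_moment 1 (exp (2 * u))"
    define t2 where "t2 = exp (9 / 2 * u) * theta_moment 2 (exp (2 * u))"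
    define t3 where "t3 = exp (13 / 2 * u) * theta_moment 3 (exp (2 * u))"
    have nonneg: "0 \<le> t1" "0 \<le> t2" "0 \<le> t3"
      unfolding t1_def t2_def t3_def by (simp_all add: theta_moment_nonneg)
    have "pi * t1 \<le> pi * (C1 * W)" "pi^2 * t2 \<le> pi^2 * (C2 * W)" "pi^3 * t3 \<le> pi^3 * (C3 * W)"
      unfolding t1_def t2_def t3_def W_def using u by (intro mult_left_mono C1(2) C2(2) C3(2); simp)+
    moreover have "0 \<le> pi * t1" "0 \<le> pi^2 * t2" "0 \<le> pi^3 * t3"
      using nonneg by simp_all
    moreover have "Phi u = 4 * (pi^2 * t2) - 6 * (pi * t1)"
      unfolding Phi_conv_theta_moment t1_def t2_def by simp
    moreover have "Phi_deriv u = 30 * (pi^2 * t2) - 8 * (pi^3 * t3) - 15 * (pi * t1)"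
      unfolding Phi_deriv_def t1_def t2_def t3_def by simp
    moreover have "?C * W = 15 * (pi * (C1 * W)) + 30 * (pi^2 * (C2 * W)) + 8 * (pi^3 * (C3 * W))"
      by (simp add: algebra_simps)
    ultimately show "\<bar>Phi u\<bar> \<le> ?C * exp (- R * u^2 - 2 * u)" "\<bar>Phi_deriv u\<bar> \<le> ?C * exp (- R * u^2 - 2 * u)"
      unfolding W_def[symmetric] by linarith+
  qed
qed

section \<open>Numerical value of \<open>A0\<close>\<close>

text \<open>Splitting e^pi = e^3 e^(pi - 3) leaves an exponent of about 0.14, for which the Taylor
  polynomial of degree 5 has an error below 4 * 10^-8, even with the crude bound 3 for the
  exponential in the remainder.\<close>

lemma exp_pi_bounds: "23.14069 \<le> exp pi" "exp pi \<le> 23.140695"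
proof -
  define d where "d = pi - 3"
  have d: "0.1415926535 \<le> d" "d \<le> 0.1415926536"
    using pi_approx unfolding d_def by simp_all
  obtain t where t: "\<bar>t\<bar> \<le> \<bar>d\<bar>" "exp d = (\<Sum>m<6. d ^ m / fact m) + exp t / fact 6 * d ^ 6"
    using Maclaurin_exp_le by blast
  define r where "r = exp t / fact 6 * d ^ 6"
  have sum_eq: "(\<Sum>m<6. d ^ m / fact m) = 1 + d + d^2 / 2 + d^3 / 6 + d^4 / 24 + d^5 / 120"
    by (simp add: eval_nat_numeral)
  have low: "0.1415926535 ^ k \<le> d ^ k" for k
    using d by (intro power_mono) auto
  have upp: "d ^ k \<le> 0.1415926536 ^ k" for k
    using d by (intro power_mono) auto
  have "exp t \<le> exp 1"
    using t(1) d by (intro exp_mono) simp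
  also have "\<dots> \<le> 3"
    by (rule exp_le)
  finally have rem: "r \<le> 3 / fact 6 * 0.1415926536 ^ 6" "0 \<le> r"
    unfolding r_def using d by (auto intro!: mult_mono divide_right_mono upp)
  have "1.15210723 \<le> exp d"
    unfolding t(2) r_def[symmetric] sum_eq using low[of 2] low[of 3] low[of 4] low[of 5] rem(2) d
    by (simp add: eval_nat_numeral)
  moreover have "exp d \<le> 1.15210727"
    unfolding t(2) r_def[symmetric] sum_eq using upp[of 2] upp[of 3] upp[of 4] upp[of 5] rem(1) d
    by (simp add: eval_nat_numeral)
  moreover have e: "2.718281828 \<le> (exp 1 :: real)" "exp 1 \<le> (2.718281829 :: real)"
    using e_approx_32 unfolding abs_le_iff by (auto simp: field_simps)
  moreover have "2.718281828 ^ 3 \<le> (exp 1 :: real) ^ 3" "exp 1 ^ 3 \<le> (2.718281829 :: real) ^ 3"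
    using e by (intro power_mono; simp)+
  ultimately have "2.718281828 ^ 3 * 1.15210723 \<le> exp 1 ^ 3 * exp d" "exp 1 ^ 3 * exp d \<le> 2.718281829 ^ 3 * 1.15210727"
    by (intro mult_mono; simp)+
  moreover have "exp pi = exp 1 ^ 3 * exp d"
    unfolding d_def by (simp add: exp_diff flip: exp_of_nat_mult)
  ultimately show "23.14069 \<le> exp pi" "exp pi \<le> 23.140695"
    by (simp_all add: eval_nat_numeral)
qed

text \<open>The n-th term contains q^(n^2). The terms n = 1 and n = 2 are kept exactly, and all
  later ones are nonnegative and sum to less than 10^-7.\<close>

lemma Phi_0_bounds:
  defines "q \<equiv> exp (- pi)"
  shows "(4 * pi^2 - 6 * pi) * q + (64 * pi^2 - 24 * pi) * q ^ 4 \<le> Phi 0"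
    and "Phi 0 \<le> (4 * pi^2 - 6 * pi) * q + (64 * pi^2 - 24 * pi) * q ^ 4 + 1 / 10 ^ 7"
proof -
  define f where "f k = (4 * pi^2 * real (Suc k)^4 - 6 * pi * real (Suc k)^2) * exp (- pi * real (Suc k)^2)" for k
  have "summable (\<lambda>k. 4 * pi^2 * (real (Suc k)^4 * exp (- pi * real (Suc k)^2 * 1))
      - 6 * pi * (real (Suc k)^2 * exp (- pi * real (Suc k)^2 * 1)))"
    by (rule summable_diff summable_mult summable_theta_moment zero_less_one)+
  then have sf: "summable f"
    unfolding f_def by (simp add: algebra_simps)
  have "Phi 0 = (\<Sum>k. f k)"
    unfolding Phi_def f_def by simp
  also have "\<dots> = (\<Sum>k. f (k + 2)) + (\<Sum>k<2. f k)"
    using suminf_split_initial_segment[OF sf] .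
  also have "(\<Sum>k<2. f k) = f 0 + f 1"
    by (simp add: numeral_2_eq_2)
  also have "f 0 = (4 * pi^2 - 6 * pi) * q"
    by (simp add: f_def q_def)
  also have "f 1 = (64 * pi^2 - 24 * pi) * q ^ 4"
    by (simp add: f_def q_def mult_ac flip: exp_of_nat_mult)
  finally have Phi_eq: "Phi 0 = (\<Sum>k. f (k + 2)) + ((4 * pi^2 - 6 * pi) * q + (64 * pi^2 - 24 * pi) * q ^ 4)" .
  have sf2: "summable (\<lambda>k. f (k + 2))"
    using sf by (simp only: summable_iff_shift)
  have f_nonneg: "f k \<ge> 0" for k
  proof -
    have "6 * pi * real (Suc k)^2 \<le> (4 * pi * pi) * real (Suc k)^4"
      using pi_gt3 by (intro mult_mono power_increasing) auto
    then show ?thesis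
      unfolding f_def by (intro mult_nonneg_nonneg) (auto simp: power2_eq_square mult_ac)
  qed
  show "(4 * pi^2 - 6 * pi) * q + (64 * pi^2 - 24 * pi) * q ^ 4 \<le> Phi 0"
    unfolding Phi_eq using suminf_nonneg[OF sf2 f_nonneg] by simp
  have q: "0 \<le> q" "q \<le> 1 / 20"
    using exp_pi_bounds(1) unfolding q_def exp_minus by (auto simp: field_simps)
  \<comment> \<open>Geometric majorant with ratio 4/20 for the terms n = k + 3: 4 pi^2 <= 40, (k +
    3)^4 <= 81 * 4^k, and q^((k+3)^2) <= (1/20)^(k+9). The negative part of each term is
    dropped.\<close>
  have f_le: "f (k + 2) \<le> (40 * 81 / 20 ^ 9) * (4 / 20) ^ k" for k
  proof -
    have "(real k + 3) ^ 4 \<le> 81 * 4 ^ k"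
    proof (induction k)
      case (Suc k)
      have "4 * (real k + 3)^4 - (real k + 4)^4 = 3 * real k ^ 4 + 32 * real k ^ 3 + 120 * real k ^ 2 + 176 * real k + 68"
        by (simp add: eval_nat_numeral algebra_simps)
      then have "(real k + 4)^4 \<le> 4 * (real k + 3)^4"
        by (smt (verit) of_nat_0_le_iff zero_le_power mult_nonneg_nonneg)
      with Suc show ?case
        by (simp add: add_ac)
    qed simp
    moreover have "4 * pi^2 \<le> 40"
    proof -
      have "pi^2 \<le> 3.15^2"
        using pi_approx(2) by (intro power_mono) simp_all
      then show ?thesis
        by (simp add: power2_eq_square)
    qed
    moreover have "exp (- pi * real (Suc (k + 2))^2) \<le> (1 / 20) ^ (k + 9)"
    proof -
      have "exp (- pi * real (Suc (k + 2))^2) = q ^ ((k + 3)^2)"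
        unfolding q_def by (simp add: exp_of_nat_mult[symmetric] power2_eq_square mult_ac add_ac algebra_simps)
      also have "\<dots> \<le> q ^ (k + 9)"
        using q by (intro power_decreasing) (auto simp: power2_eq_square algebra_simps)
      also have "\<dots> \<le> (1 / 20) ^ (k + 9)"
        using q by (intro power_mono)
      finally show ?thesis .
    qed
    ultimately have "4 * pi^2 * (real k + 3) ^ 4 * exp (- pi * real (Suc (k + 2))^2) \<le> 40 * (81 * 4 ^ k) * (1 / 20) ^ (k + 9)"
      by (intro mult_mono) auto
    moreover have "f (k + 2) \<le> 4 * pi^2 * (real k + 3) ^ 4 * exp (- pi * real (Suc (k + 2))^2)"
      unfolding f_def by (intro mult_right_mono) (auto simp: add_ac)
    moreover have "40 * (81 * 4 ^ k) * (1 / 20) ^ (k + 9) = (40 * 81 / 20 ^ 9) * (4 / 20 :: real) ^ k"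
      by (simp only: power_add power_divide power_one) simp
    ultimately show ?thesis
      by linarith
  qed
  have geo: "(\<lambda>k. (40 * 81 / 20 ^ 9) * (4 / 20) ^ k) sums ((40 * 81 / 20 ^ 9) * (1 / (1 - 4 / 20 :: real)))"
    by (intro sums_mult geometric_sums) simp
  have "(\<Sum>k. f (k + 2)) \<le> (40 * 81 / 20 ^ 9) * (1 / (1 - 4 / 20))"
    using suminf_le[OF f_le sf2 sums_summable[OF geo]] sums_unique[OF geo] by simp
  also have "\<dots> \<le> 1 / 10 ^ 7"
    by simp
  finally show "Phi 0 \<le> (4 * pi^2 - 6 * pi) * q + (64 * pi^2 - 24 * pi) * q ^ 4 + 1 / 10 ^ 7"
    unfolding Phi_eq by simp
qed

lemma A0_approx: "\<bar>A0 - 2.80668\<bar> \<le> 0.000005"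
proof -
  define q where "q = exp (- pi)"
  have pi: "3.1415926535 \<le> pi" "pi \<le> 3.1415926536"
    using pi_approx by simp_all
  have pi2: "3.1415926535 ^ 2 \<le> pi ^ 2" "pi ^ 2 \<le> 3.1415926536 ^ 2"
    using pi by (intro power_mono; simp)+
  have q: "1 / 23.140695 \<le> q" "q \<le> 1 / 23.14069"
    unfolding q_def exp_minus using exp_pi_bounds by (auto simp: divide_simps)
  have q4: "(1 / 23.140695) ^ 4 \<le> q ^ 4" "q ^ 4 \<le> (1 / 23.14069) ^ 4"
    using q by (intro power_mono; simp)+
  have "20.628861 \<le> 4 * pi^2 - 6 * pi" "4 * pi^2 - 6 * pi \<le> 20.628862"
    using pi pi2 by (simp_all add: power2_eq_square)
  moreover have "556.25 \<le> 64 * pi^2 - 24 * pi" "64 * pi^2 - 24 * pi \<le> 556.26"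
    using pi pi2 by (simp_all add: power2_eq_square)
  ultimately have
    "20.628861 * (1 / 23.140695) + 556.25 * (1 / 23.140695) ^ 4 \<le> (4 * pi^2 - 6 * pi) * q + (64 * pi^2 - 24 * pi) * q ^ 4"
    "(4 * pi^2 - 6 * pi) * q + (64 * pi^2 - 24 * pi) * q ^ 4 \<le> 20.628862 * (1 / 23.14069) + 556.26 * (1 / 23.14069) ^ 4"
    using q q4 by (intro add_mono mult_mono; simp)+
  \<comment> \<open>A window of width 2 * 10^-6 is enough: multiplied by pi it stays within the
    target interval of width 10^-5.\<close>
  then have "0.893393 \<le> Phi 0" "Phi 0 \<le> 0.893395"
    using Phi_0_bounds unfolding q_def by (simp_all add: eval_nat_numeral)
  then have "3.1415926535 * 0.893393 \<le> A0" "A0 \<le> 3.1415926536 * 0.893395"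
    unfolding A0_def using pi by (intro mult_mono; simp)+
  then show ?thesis
    unfolding abs_le_iff by simp
qed

section \<open>The weight g and its decay\<close>

definition xi_weight :: "real \<Rightarrow> real \<Rightarrow> real" where
  "xi_weight lam u = exp (lam * u^2) * Phi u"

definition xi_weight_deriv :: "real \<Rightarrow> real \<Rightarrow> real" where
  "xi_weight_deriv lam u = exp (lam * u^2) * (2 * lam * u * Phi u + Phi_deriv u)"

lemma xi_weight_has_real_derivative [derivative_intros]:
  "(xi_weight lam has_real_derivative xi_weight_deriv lam u) (at u)"
  unfolding xi_weight_def[abs_def] xi_weight_deriv_def
  by (rule derivative_eq_intros refl Phi_has_real_derivative)+ (simp add: algebra_simps power2_eq_square)

lemma continuous_on_xi_weight [continuous_intros]:
  "continuous_on S f \<Longrightarrow> continuous_on S (\<lambda>u. xi_weight lam (f u))"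
  unfolding xi_weight_def
  by (intro continuous_intros continuous_on_compose2[OF continuous_on_Phi[of UNIV]]) auto

lemma continuous_on_xi_weight_deriv [continuous_intros]:
  "continuous_on S f \<Longrightarrow> continuous_on S (\<lambda>u. xi_weight_deriv lam (f u))"
  unfolding xi_weight_deriv_def
  by (intro continuous_intros continuous_on_compose2[OF continuous_on_Phi[of UNIV]]
      continuous_on_compose2[OF continuous_on_Phi_deriv[of UNIV]]) auto

lemma continuous_on_Si [continuous_intros]:
  assumes "continuous_on S f"
  shows "continuous_on S (\<lambda>x. Si (f x))"
proof -
  have "continuous_on UNIV Si"
    by (rule continuous_at_imp_continuous_on) (simp add: isCont_Si)
  then show ?thesis
    using assms by (rule continuous_on_compose2) simp
qed

lemma xi_weight_0: "xi_weight lam 0 = Phi 0"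
  by (simp add: xi_weight_def)

text \<open>\<open>Phi_decay\<close> with R = lam + 1 cancels exp(lam u^2) and leaves exp(-u^2 -
  2u). One factor exp(-u) absorbs the u of the derivative 2 lam u. The Gaussian that remains
  controls sin(zu) for complex z.\<close>

lemma xi_weight_decay:
  obtains C where "C > 0" "\<And>u. u \<ge> 0 \<Longrightarrow> \<bar>xi_weight lam u\<bar> \<le> C * exp (- (u^2) - u)"
    "\<And>u. u \<ge> 0 \<Longrightarrow> \<bar>xi_weight_deriv lam u\<bar> \<le> C * exp (- (u^2) - u)"
proof -
  obtain C where C: "C > 0"
    "\<And>u. u \<ge> 0 \<Longrightarrow> \<bar>Phi u\<bar> \<le> C * exp (- (lam + 1) * u^2 - 2 * u)"
    "\<And>u. u \<ge> 0 \<Longrightarrow> \<bar>Phi_deriv u\<bar> \<le> C * exp (- (lam + 1) * u^2 - 2 * u)"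
    using Phi_decay[of "lam + 1"] by metis
  have le: "exp (lam * u^2) * \<bar>y\<bar> \<le> C * exp (- (u^2) - 2 * u)"
    if "\<bar>y\<bar> \<le> C * exp (- (lam + 1) * u^2 - 2 * u)" for u y
  proof -
    have "exp (lam * u^2) * \<bar>y\<bar> \<le> exp (lam * u^2) * (C * exp (- (lam + 1) * u^2 - 2 * u))"
      using that by (intro mult_left_mono) auto
    also have "\<dots> = C * exp (lam * u^2 + (- (lam + 1) * u^2 - 2 * u))"
      by (simp only: exp_add mult_ac)
    also have "lam * u^2 + (- (lam + 1) * u^2 - 2 * u) = - (u^2) - 2 * u"
      by (simp add: algebra_simps)
    finally show ?thesis .
  qed
  show ?thesis
  proof (rule that)
    show "(2 * \<bar>lam\<bar> + 1) * C > 0"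
      using C(1) by (intro mult_pos_pos) auto
    fix u :: real
    assume u: "u \<ge> 0"
    have split: "exp (- (u^2) - 2 * u) = exp (- (u^2) - u) * exp (- u)"
      by (simp flip: exp_add)
    have "C * exp (- (u^2) - 2 * u) \<le> C * exp (- (u^2) - u)"
      using C(1) u by simp
    then have exp_le: "C * exp (- (u^2) - 2 * u) \<le> (2 * \<bar>lam\<bar> + 1) * C * exp (- (u^2) - u)"
      using C(1) by (smt (verit) mult_right_mono mult_nonneg_nonneg exp_ge_zero mult.assoc mult_cancel_right1)
    have "\<bar>xi_weight lam u\<bar> = exp (lam * u^2) * \<bar>Phi u\<bar>"
      by (simp add: xi_weight_def abs_mult)
    with le[OF C(2)[OF u]] exp_le show "\<bar>xi_weight lam u\<bar> \<le> (2 * \<bar>lam\<bar> + 1) * C * exp (- (u^2) - u)"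
      by linarith
    have "u * exp (- u) \<le> 1"
      using order_trans[OF _ exp_ge_add_one_self, of u u] by (simp add: exp_minus field_simps)
    then have "u * exp (- u) * (2 * \<bar>lam\<bar> * C * exp (- (u^2) - u)) \<le> 1 * (2 * \<bar>lam\<bar> * C * exp (- (u^2) - u))"
      using C(1) by (intro mult_right_mono) auto
    moreover have "\<bar>xi_weight_deriv lam u\<bar> \<le> 2 * \<bar>lam\<bar> * u * (exp (lam * u^2) * \<bar>Phi u\<bar>) + exp (lam * u^2) * \<bar>Phi_deriv u\<bar>"
    proof -
      have "\<bar>2 * lam * u * Phi u + Phi_deriv u\<bar> \<le> 2 * \<bar>lam\<bar> * u * \<bar>Phi u\<bar> + \<bar>Phi_deriv u\<bar>"
        using abs_triangle_ineq[of "2 * lam * u * Phi u" "Phi_deriv u"] u by (simp add: abs_mult)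
      then have "exp (lam * u^2) * \<bar>2 * lam * u * Phi u + Phi_deriv u\<bar>
          \<le> exp (lam * u^2) * (2 * \<bar>lam\<bar> * u * \<bar>Phi u\<bar> + \<bar>Phi_deriv u\<bar>)"
        by (intro mult_left_mono) auto
      then show ?thesis
        unfolding xi_weight_deriv_def abs_mult by (simp add: distrib_left mult_ac)
    qed
    moreover have "2 * \<bar>lam\<bar> * u * (exp (lam * u^2) * \<bar>Phi u\<bar>) \<le> 2 * \<bar>lam\<bar> * u * (C * exp (- (u^2) - 2 * u))"
      using u le[OF C(2)[OF u]] by (intro mult_left_mono) auto
    moreover note le[OF C(3)[OF u]] \<open>C * exp (- (u^2) - 2 * u) \<le> C * exp (- (u^2) - u)\<close>
    ultimately show "\<bar>xi_weight_deriv lam u\<bar> \<le> (2 * \<bar>lam\<bar> + 1) * C * exp (- (u^2) - u)"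
      unfolding split by (simp add: algebra_simps)
  qed
qed

text \<open>Absorbs a linear factor into a Gaussian: u in the decay of the weight, |z| in the growth
  of Xi.\<close>

lemma le_exp_square: "r \<le> exp (r^2)" for r :: real
proof -
  have "0 \<le> (r - 1 / 2)^2"
    by simp
  then have "r \<le> 1 + r^2"
    by (simp add: power2_eq_square field_simps)
  also have "\<dots> \<le> exp (r^2)"
    by (rule exp_ge_add_one_self)
  finally show ?thesis .
qed

text \<open>Here the Gaussian is spent on the factor u of the third bound, which the function g - u
  g' of the positivity argument requires.\<close>

lemma xi_weight_exp_decay:
  obtains C where "C > 0" "\<And>u. u \<ge> 0 \<Longrightarrow> \<bar>xi_weight lam u\<bar> \<le> C * exp (- u)"
    "\<And>u. u \<ge> 0 \<Longrightarrow> \<bar>xi_weight_deriv lam u\<bar> \<le> C * exp (- u)"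
    "\<And>u. u \<ge> 0 \<Longrightarrow> u * \<bar>xi_weight_deriv lam u\<bar> \<le> C * exp (- u)"
proof -
  obtain C where C: "C > 0" "\<And>u. u \<ge> 0 \<Longrightarrow> \<bar>xi_weight lam u\<bar> \<le> C * exp (- (u^2) - u)"
    "\<And>u. u \<ge> 0 \<Longrightarrow> \<bar>xi_weight_deriv lam u\<bar> \<le> C * exp (- (u^2) - u)"
    using xi_weight_decay by metis
  have le: "C * exp (- (u^2) - u) \<le> C * exp (- u)" for u
    using C(1) by simp
  have le': "u * (C * exp (- (u^2) - u)) \<le> C * exp (- u)" for u
  proof -
    have "u \<le> exp (u^2)"
      by (rule le_exp_square)
    then have "u * exp (- (u^2)) \<le> 1"
      by (simp add: exp_minus field_simps)
    then have "u * exp (- (u^2)) * (C * exp (- u)) \<le> 1 * (C * exp (- u))"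
      using C(1) by (intro mult_right_mono) auto
    then show ?thesis
      by (simp add: exp_diff exp_minus field_simps)
  qed
  show ?thesis
  proof (rule that[OF C(1)])
    fix u :: real
    assume u: "u \<ge> 0"
    show "\<bar>xi_weight lam u\<bar> \<le> C * exp (- u)" "\<bar>xi_weight_deriv lam u\<bar> \<le> C * exp (- u)"
      using C(2,3)[OF u] le[of u] by linarith+
    show "u * \<bar>xi_weight_deriv lam u\<bar> \<le> C * exp (- u)"
      using order_trans[OF mult_left_mono[OF C(3)[OF u] u] le'] .
  qed
qed

section \<open>Integration by parts and the limit along the real axis\<close>

lemma set_integrable_exp_decay:
  fixes f :: "real \<Rightarrow> 'a :: {banach, second_countable_topology}"
  assumes "continuous_on {0<..} f" "\<And>u. u > 0 \<Longrightarrow> norm (f u) \<le> C * exp (- u)"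
  shows "set_integrable lborel {0<..} f"
proof (rule set_integrable_bound)
  show "set_integrable lborel {0<..} (\<lambda>u::real. C * exp (- u))"
    using integrable_I0i_exp_mscale[of 1] by simp
  show "set_borel_measurable lborel {0<..} f"
    unfolding set_borel_measurable_def using assms(1)
    by (simp add: borel_measurable_continuous_on_indicator)
  show "AE u in lborel. u \<in> {0<..} \<longrightarrow> norm (f u) \<le> norm (C * exp (- u))"
    using order_trans[OF assms(2) abs_ge_self] by (intro AE_I2) auto
qed

text \<open>Integrations by parts are carried out by integrating the derivative of a product. The
  boundary values are one-sided limits because the integrands divide by u.\<close>

lemma LINT_FTC_0_infinity:
  fixes f F :: "real \<Rightarrow> real"
  assumes "\<And>u. u > 0 \<Longrightarrow> (F has_real_derivative f u) (at u)"
    and "continuous_on {0<..} f" and "set_integrable lborel {0<..} f"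
    and "(F \<longlongrightarrow> A) (at_right 0)" "(F \<longlongrightarrow> B) at_top"
  shows "(LINT u:{0<..}|lborel. f u) = B - A"
proof -
  have "(LBINT u=0..\<infinity>. f u) = B - A"
  proof (rule interval_integral_FTC_integrable)
    show "(F has_vector_derivative f u) (at u)" if "0 < ereal u" for u
      using assms(1) that by (simp add: has_real_derivative_iff_has_vector_derivative)
    show "isCont f u" if "0 < ereal u" for u
      using assms(2) that continuous_on_eq_continuous_at[of "{0<..}" f] by simp
    show "set_integrable lborel (einterval 0 \<infinity>) f"
      using assms(3) by (simp add: zero_ereal_def)
    show "((F \<circ> real_of_ereal) \<longlongrightarrow> A) (at_right 0)"
      using assms(4) unfolding zero_ereal_def by (simp add: ereal_tendsto_simps)
    show "((F \<circ> real_of_ereal) \<longlongrightarrow> B) (at_left \<infinity>)"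
      using assms(5) by (simp add: ereal_tendsto_simps)
  qed simp
  then show ?thesis
    by (simp add: interval_lebesgue_integral_0_infty)
qed

lemma xi_weight_tendsto_0: "(xi_weight lam \<longlongrightarrow> 0) at_top"
proof -
  obtain C where C: "\<And>u. u \<ge> 0 \<Longrightarrow> \<bar>xi_weight lam u\<bar> \<le> C * exp (- u)"
    using xi_weight_exp_decay by metis
  have "((\<lambda>u. C * exp (- u)) \<longlongrightarrow> 0) at_top"
    by real_asymp
  then show ?thesis
  proof (rule Lim_null_comparison[rotated])
    show "\<forall>\<^sub>F u in at_top. norm (xi_weight lam u) \<le> C * exp (- u)"
      using eventually_ge_at_top[of 0] by eventually_elim (simp add: C)
  qed
qed

lemma xi_weight_at_right_0: "(xi_weight lam \<longlongrightarrow> Phi 0) (at_right 0)"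
  using DERIV_isCont[OF xi_weight_has_real_derivative[of lam 0]]
  by (auto simp: isCont_def xi_weight_0 intro: tendsto_mono[rotated] at_le)

lemma set_integrable_xi_weight_deriv_Si:
  "set_integrable lborel {0<..} (\<lambda>u. xi_weight_deriv lam u * Si (t * u))"
proof -
  obtain M where M: "\<And>x. \<bar>Si x\<bar> \<le> M"
    using bounded_Si by blast
  obtain C where C: "C > 0" "\<And>u. u \<ge> 0 \<Longrightarrow> \<bar>xi_weight_deriv lam u\<bar> \<le> C * exp (- u)"
    using xi_weight_exp_decay by metis
  show ?thesis
  proof (rule set_integrable_exp_decay)
    show "continuous_on {0<..} (\<lambda>u. xi_weight_deriv lam u * Si (t * u))"
      by (intro continuous_intros)
    show "norm (xi_weight_deriv lam u * Si (t * u)) \<le> C * M * exp (- u)" if "u > 0" for u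
    proof -
      have "\<bar>xi_weight_deriv lam u\<bar> * \<bar>Si (t * u)\<bar> \<le> (C * exp (- u)) * M"
        using C that M by (intro mult_mono) auto
      then show ?thesis
        by (simp add: abs_mult mult_ac)
    qed
  qed
qed

lemma abs_sin_div_le:
  fixes t u :: real
  assumes "u > 0"
  shows "\<bar>sin (t * u) / u\<bar> \<le> \<bar>t\<bar>"
  using abs_sin_x_le_abs_x[of "t * u"] assms by (simp add: abs_mult divide_simps)

lemma set_integrable_xi_weight_sin:
  "set_integrable lborel {0<..} (\<lambda>u. xi_weight lam u * (sin (t * u) / u))"
proof -
  obtain C where C: "C > 0" "\<And>u. u \<ge> 0 \<Longrightarrow> \<bar>xi_weight lam u\<bar> \<le> C * exp (- u)"
    using xi_weight_exp_decay by metis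
  show ?thesis
  proof (rule set_integrable_exp_decay)
    show "continuous_on {0<..} (\<lambda>u. xi_weight lam u * (sin (t * u) / u))"
      by (intro continuous_intros) auto
    show "norm (xi_weight lam u * (sin (t * u) / u)) \<le> C * \<bar>t\<bar> * exp (- u)" if "u > 0" for u
    proof -
      have "\<bar>xi_weight lam u\<bar> * \<bar>sin (t * u) / u\<bar> \<le> (C * exp (- u)) * \<bar>t\<bar>"
        using C that abs_sin_div_le[OF that] by (intro mult_mono) auto
      then show ?thesis
        by (simp add: abs_mult mult_ac)
    qed
  qed
qed

text \<open>sin(tu)/u is the u-derivative of Si(tu). Both boundary terms vanish: Si is 0 at 0, and
  at infinity g tends to 0 while Si stays bounded.\<close>

lemma LINT_xi_weight_sin_conv_Si:
  assumes "t > 0"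
  shows "(LINT u:{0<..}|lborel. xi_weight lam u * (sin (t * u) / u))
    = - (LINT u:{0<..}|lborel. xi_weight_deriv lam u * Si (t * u))"
proof -
  obtain M where M: "\<And>x. \<bar>Si x\<bar> \<le> M"
    using bounded_Si by blast
  have "(LINT u:{0<..}|lborel. xi_weight_deriv lam u * Si (t * u) + xi_weight lam u * (sin (t * u) / u)) = 0 - 0"
  proof (rule LINT_FTC_0_infinity)
    show "((\<lambda>u. xi_weight lam u * Si (t * u)) has_real_derivative
        xi_weight_deriv lam u * Si (t * u) + xi_weight lam u * (sin (t * u) / u)) (at u)" if "u > 0" for u
    proof -
      have "((\<lambda>u. Si (t * u)) has_real_derivative sinc (t * u) * t) (at u)"
        by (rule DERIV_chain2[where f = Si, OF DERIV_Si]) (auto intro!: derivative_eq_intros)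
      from DERIV_mult[OF xi_weight_has_real_derivative this] show ?thesis
        using that assms by (simp add: field_simps)
    qed
    show "continuous_on {0<..} (\<lambda>u. xi_weight_deriv lam u * Si (t * u) + xi_weight lam u * (sin (t * u) / u))"
      by (intro continuous_intros) auto
    show "set_integrable lborel {0<..} (\<lambda>u. xi_weight_deriv lam u * Si (t * u) + xi_weight lam u * (sin (t * u) / u))"
      by (intro set_integral_add set_integrable_xi_weight_deriv_Si set_integrable_xi_weight_sin)
    have "((\<lambda>u. Si (t * u)) \<longlongrightarrow> Si (t * 0)) (at_right 0)"
      by (rule isCont_tendsto_compose[OF isCont_Si]) (intro tendsto_intros)
    from tendsto_mult[OF xi_weight_at_right_0 this]
    show "((\<lambda>u. xi_weight lam u * Si (t * u)) \<longlongrightarrow> 0) (at_right 0)"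
      by (simp add: Si_def zero_ereal_def)
    show "((\<lambda>u. xi_weight lam u * Si (t * u)) \<longlongrightarrow> 0) at_top"
    proof (rule Lim_null_comparison)
      show "\<forall>\<^sub>F u in at_top. norm (xi_weight lam u * Si (t * u)) \<le> \<bar>xi_weight lam u\<bar> * M"
        using M by (auto intro!: always_eventually mult_left_mono simp: abs_mult)
      show "((\<lambda>u. \<bar>xi_weight lam u\<bar> * M) \<longlongrightarrow> 0) at_top"
        by (intro tendsto_mult_left_zero tendsto_rabs_zero xi_weight_tendsto_0)
    qed
  qed
  then show ?thesis
    by (subst (asm) set_integral_add)
       (simp_all only: set_integrable_xi_weight_deriv_Si set_integrable_xi_weight_sin diff_self add_eq_0_iff)
qed

text \<open>The majorant |t| |g(u)| of the original integrand grows with t. After integration by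
  parts t occurs only inside the bounded function Si, so a multiple of exp(-u) dominates uniformly
  in t. The integral of g' is -g(0), which restores the sign.\<close>

lemma LINT_xi_weight_sin_tendsto:
  "((\<lambda>t. LINT u:{0<..}|lborel. xi_weight lam u * (sin (t * u) / u)) \<longlongrightarrow> pi / 2 * Phi 0) at_top"
proof -
  obtain M where M: "\<And>x. \<bar>Si x\<bar> \<le> M"
    using bounded_Si by blast
  obtain C where C: "C > 0" "\<And>u. u \<ge> 0 \<Longrightarrow> \<bar>xi_weight_deriv lam u\<bar> \<le> C * exp (- u)"
    using xi_weight_exp_decay by metis
  have int: "set_integrable lborel {0<..} (xi_weight_deriv lam)"
    by (rule set_integrable_exp_decay[of _ C]) (use C in \<open>auto intro!: continuous_intros\<close>)
  have "((\<lambda>t. LINT u:{0<..}|lborel. xi_weight_deriv lam u * Si (t * u)) \<longlongrightarrow>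
      (LINT u:{0<..}|lborel. xi_weight_deriv lam u * (pi / 2))) at_top"
    unfolding set_lebesgue_integral_def
  proof (rule integral_dominated_convergence_at_top)
    show "(\<lambda>u. indicator {0<..} u *\<^sub>R (xi_weight_deriv lam u * (pi / 2))) \<in> borel_measurable lborel"
      "(\<lambda>u. indicator {0<..} u *\<^sub>R (xi_weight_deriv lam u * Si (t * u))) \<in> borel_measurable lborel" for t
      using set_integrable_xi_weight_deriv_Si[of lam t] int
      by (auto simp: set_integrable_def mult_ac dest: borel_measurable_integrable)
    show "integrable lborel (\<lambda>u. indicator {0<..} u *\<^sub>R (C * M * exp (- u)))"
      using integrable_I0i_exp_mscale[of 1] unfolding set_integrable_def[symmetric] by simp
    show "\<forall>\<^sub>F t in at_top. AE u in lborel. norm (indicator {0<..} u *\<^sub>R (xi_weight_deriv lam u * Si (t * u)))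
        \<le> indicator {0<..} u *\<^sub>R (C * M * exp (- u))"
    proof (intro always_eventually allI AE_I2)
      fix t u
      have "\<bar>xi_weight_deriv lam u\<bar> * \<bar>Si (t * u)\<bar> \<le> (C * exp (- u)) * M" if "u > 0"
        using C that M by (intro mult_mono) auto
      then show "norm (indicator {0<..} u *\<^sub>R (xi_weight_deriv lam u * Si (t * u)))
          \<le> indicator {0<..} u *\<^sub>R (C * M * exp (- u))"
        by (auto simp: abs_mult mult_ac split: split_indicator)
    qed
    show "AE u in lborel. ((\<lambda>t. indicator {0<..} u *\<^sub>R (xi_weight_deriv lam u * Si (t * u))) \<longlongrightarrow>
        indicator {0<..} u *\<^sub>R (xi_weight_deriv lam u * (pi / 2))) at_top"
    proof (intro AE_I2)
      fix u
      have "((\<lambda>t. Si (t * u)) \<longlongrightarrow> pi / 2) at_top" if "u > 0"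
        by (rule filterlim_compose[OF Si_at_top]) (use that in real_asymp)
      from tendsto_mult[OF tendsto_const this]
      show "((\<lambda>t. indicator {0<..} u *\<^sub>R (xi_weight_deriv lam u * Si (t * u))) \<longlongrightarrow>
        indicator {0<..} u *\<^sub>R (xi_weight_deriv lam u * (pi / 2))) at_top"
        by (cases "u > 0") simp_all
    qed
  qed
  moreover have "(LINT u:{0<..}|lborel. xi_weight_deriv lam u) = 0 - Phi 0"
    by (rule LINT_FTC_0_infinity[where F = "xi_weight lam"])
       (intro xi_weight_has_real_derivative int xi_weight_at_right_0 xi_weight_tendsto_0 continuous_intros)+
  ultimately have "((\<lambda>t. LINT u:{0<..}|lborel. xi_weight_deriv lam u * Si (t * u)) \<longlongrightarrow> - (pi / 2 * Phi 0)) at_top"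
    by (simp add: mult.commute)
  from tendsto_minus[OF this]
  have "((\<lambda>t. - (LINT u:{0<..}|lborel. xi_weight_deriv lam u * Si (t * u))) \<longlongrightarrow> pi / 2 * Phi 0) at_top"
    by simp
  then show ?thesis
    by (rule Lim_transform_eventually)
       (rule eventually_mono[OF eventually_gt_at_top[of 0]], simp only: LINT_xi_weight_sin_conv_Si)
qed

section \<open>Power series and growth in the complex plane\<close>

text \<open>After an index shift, 1/(n+1)! <= 1/n! compares the sum with the exponential series,
  uniformly in \<open>N\<close>. The truncated exponent \<open>n - 1\<close> at n = 0 is harmless
  because \<open>sin_coeff 0\<close> is 0.\<close>

lemma sin_power_series_bound:
  fixes z :: complex
  assumes "u > 0"
  shows "norm (\<Sum>n<N. sin_coeff n *\<^sub>R (z ^ n * of_real u ^ (n - 1))) \<le> norm z * exp (norm z * u)"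
proof -
  have "norm (\<Sum>n<N. sin_coeff n *\<^sub>R (z ^ n * of_real u ^ (n - 1)))
      \<le> (\<Sum>n<N. norm (sin_coeff n *\<^sub>R (z ^ n * of_real u ^ (n - 1))))"
    by (rule norm_sum)
  also have "\<dots> \<le> (\<Sum>n<Suc N. norm (sin_coeff n *\<^sub>R (z ^ n * of_real u ^ (n - 1))))"
    by simp
  also have "\<dots> = (\<Sum>n<N. norm (sin_coeff (Suc n) *\<^sub>R (z ^ Suc n * of_real u ^ n)))"
    by (subst sum.lessThan_Suc_shift) simp
  also have "\<dots> \<le> (\<Sum>n<N. norm z * ((norm z * u) ^ n /\<^sub>R fact n))"
  proof (rule sum_mono)
    fix n
    have "\<bar>sin_coeff (Suc n)\<bar> \<le> 1 / fact (Suc n)"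
      by (simp add: sin_coeff_def abs_mult power_abs)
    also have "\<dots> \<le> 1 / fact n"
      by (intro divide_left_mono fact_mono) auto
    finally have "\<bar>sin_coeff (Suc n)\<bar> * (norm z ^ Suc n * u ^ n) \<le> 1 / fact n * (norm z ^ Suc n * u ^ n)"
      using assms by (intro mult_right_mono) auto
    then show "norm (sin_coeff (Suc n) *\<^sub>R (z ^ Suc n * of_real u ^ n)) \<le> norm z * ((norm z * u) ^ n /\<^sub>R fact n)"
      using assms by (simp add: norm_mult norm_power power_mult_distrib field_simps)
  qed
  also have "\<dots> = norm z * (\<Sum>n<N. (norm z * u) ^ n /\<^sub>R fact n)"
    by (simp add: sum_distrib_left)
  also have "\<dots> \<le> norm z * exp (norm z * u)"
    unfolding exp_def using assms
    by (intro mult_left_mono sum_le_suminf summable_exp_generic) auto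
  finally show ?thesis .
qed

lemma sin_power_series_sums:
  fixes z :: complex
  assumes "u > 0"
  shows "(\<lambda>n. sin_coeff n *\<^sub>R (z ^ n * of_real u ^ (n - 1))) sums (sin (z * of_real u) / of_real u)"
proof -
  have "(\<lambda>n. sin_coeff n *\<^sub>R (z * of_real u) ^ n / of_real u) sums (sin (z * of_real u) / of_real u)"
    by (intro sums_divide sin_converges)
  moreover have "sin_coeff n *\<^sub>R (z * of_real u) ^ n / of_real u = sin_coeff n *\<^sub>R (z ^ n * of_real u ^ (n - 1))" for n
    using assms by (cases n) (auto simp: power_mult_distrib scaleR_conv_of_real)
  ultimately show ?thesis
    by simp
qed

lemma norm_sin_div_le:
  fixes z :: complex
  assumes "u > 0"
  shows "norm (sin (z * of_real u) / of_real u) \<le> norm z * exp (norm z * u)"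
  by (rule LIMSEQ_le_const2[OF tendsto_norm[OF sin_power_series_sums[OF assms, unfolded sums_def]]])
     (use sin_power_series_bound[OF assms] in blast)

text \<open>Here r stands for |z|. The u^2 in r u <= r^2 + u^2 is cancelled by the Gaussian of the
  weight; the remaining r^2 and the one from r <= exp(r^2) add up to the exponent 2 r^2.\<close>

lemma xi_weight_exp_growth:
  assumes "\<And>u. u \<ge> 0 \<Longrightarrow> \<bar>xi_weight lam u\<bar> \<le> C * exp (- (u^2) - u)" and "C > 0" and "u \<ge> 0"
  shows "\<bar>xi_weight lam u\<bar> * (r * exp (r * u)) \<le> C * exp (2 * r^2) * exp (- u)"
proof -
  \<comment> \<open>This sum of squares equals r^2 + u^2 - r u.\<close>
  have "0 \<le> (r / 2 - u)^2 + 3 / 4 * r^2"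
    by simp
  then have ru: "r * u \<le> r^2 + u^2"
    by (simp add: power2_eq_square field_simps)
  have "\<bar>xi_weight lam u\<bar> * (r * exp (r * u)) \<le> \<bar>xi_weight lam u\<bar> * (exp (r^2) * exp (r * u))"
    by (intro mult_left_mono mult_right_mono le_exp_square) auto
  also have "\<dots> \<le> (C * exp (- (u^2) - u)) * (exp (r^2) * exp (r^2 + u^2))"
    using assms ru by (intro mult_mono) auto
  also have "\<dots> = C * exp ((- (u^2) - u) + (r^2 + (r^2 + u^2)))"
    by (simp only: exp_add mult_ac)
  also have "(- (u^2) - u) + (r^2 + (r^2 + u^2)) = 2 * r^2 + - u"
    by simp
  finally show ?thesis
    by (simp only: exp_add mult_ac)
qed

definition xi_integral :: "real \<Rightarrow> complex \<Rightarrow> complex" where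
  "xi_integral lam z = (LINT u:{0<..}|lborel. of_real (xi_weight lam u) * (sin (z * of_real u) / of_real u))"

lemma Xi_m1_conv_xi_integral: "Xi_m1 lam z = 2 * xi_integral lam z"
  by (simp add: Xi_m1_def xi_integral_def xi_weight_def)

lemma xi_integral_of_real:
  "xi_integral lam (of_real t) = of_real (LINT u:{0<..}|lborel. xi_weight lam u * (sin (t * u) / u))"
proof -
  have "xi_integral lam (of_real t) = (LINT u:{0<..}|lborel. of_real (xi_weight lam u * (sin (t * u) / u)))"
    unfolding xi_integral_def by (simp add: sin_of_real flip: of_real_mult)
  then show ?thesis
    by (simp only: set_integral_complex_of_real)
qed

lemma xi_integral_minus: "xi_integral lam (- z) = - xi_integral lam z"
  by (simp add: xi_integral_def set_lebesgue_integral_def)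

lemma xi_integral_growth:
  obtains C where "C > 0" "\<And>z. norm (xi_integral lam z) \<le> C * exp (2 * (norm z)^2)"
proof -
  obtain C where C: "C > 0" "\<And>u. u \<ge> 0 \<Longrightarrow> \<bar>xi_weight lam u\<bar> \<le> C * exp (- (u^2) - u)"
    using xi_weight_decay by metis
  show ?thesis
  proof (rule that)
    define I where "I = (LINT u:{0<..}|lborel. exp (- u) :: real)"
    have "I \<ge> 0"
      unfolding I_def set_lebesgue_integral_def by (intro Bochner_Integration.integral_nonneg) auto
    show "C * (I + 1) > 0"
      using C(1) \<open>I \<ge> 0\<close> by simp
    fix z :: complex
    have bound: "norm (of_real (xi_weight lam u) * (sin (z * of_real u) / of_real u)) \<le> C * exp (2 * (norm z)^2) * exp (- u)"
      if "u > 0" for u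
    proof -
      have "\<bar>xi_weight lam u\<bar> * norm (sin (z * of_real u) / of_real u) \<le> \<bar>xi_weight lam u\<bar> * (norm z * exp (norm z * u))"
        by (intro mult_left_mono norm_sin_div_le that) auto
      also have "\<dots> \<le> C * exp (2 * (norm z)^2) * exp (- u)"
        using C that by (intro xi_weight_exp_growth) auto
      finally show ?thesis
        by (simp only: norm_mult norm_of_real)
    qed
    have "norm (xi_integral lam z) \<le> (LINT u:{0<..}|lborel. norm (of_real (xi_weight lam u) * (sin (z * of_real u) / of_real u)))"
      unfolding xi_integral_def
    proof (rule set_integral_norm_bound)
      show "set_integrable lborel {0<..} (\<lambda>u. of_real (xi_weight lam u) * (sin (z * of_real u) / of_real u))"
        by (rule set_integrable_exp_decay[OF _ bound]) (auto intro!: continuous_intros)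
    qed
    also have "\<dots> \<le> (LINT u:{0<..}|lborel. C * exp (2 * (norm z)^2) * exp (- u))"
    proof (rule set_integral_mono)
      show "set_integrable lborel {0<..} (\<lambda>u. norm (of_real (xi_weight lam u) * (sin (z * of_real u) / of_real u)))"
        by (rule set_integrable_exp_decay) (use bound in \<open>auto intro!: continuous_intros\<close>)
      show "set_integrable lborel {0<..} (\<lambda>u. C * exp (2 * (norm z)^2) * exp (- u))"
        by (rule set_integrable_exp_decay[where C = "C * exp (2 * (norm z)^2)"])
           (use C(1) in \<open>auto intro!: continuous_intros\<close>)
    qed (use bound in auto)
    also have "\<dots> = C * exp (2 * (norm z)^2) * I"
      by (simp add: I_def)
    also have "\<dots> \<le> C * (I + 1) * exp (2 * (norm z)^2)"
      using C(1) by (simp add: algebra_simps)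
    finally show "norm (xi_integral lam z) \<le> C * (I + 1) * exp (2 * (norm z)^2)" .
  qed
qed

text \<open>Termwise integration of the sine series; the coefficients are moments of the weight.
  Convergence everywhere then yields that the integral is entire.\<close>

lemma xi_integral_power_series:
  obtains c where "\<And>z. (\<lambda>n. c n * z ^ n) sums xi_integral lam z"
proof
  fix z :: complex
  define c where "c n = of_real (sin_coeff n) * (LINT u:{0<..}|lborel. of_real (xi_weight lam u) * of_real u ^ (n - 1) :: complex)" for n
  obtain C where C: "C > 0" "\<And>u. u \<ge> 0 \<Longrightarrow> \<bar>xi_weight lam u\<bar> \<le> C * exp (- (u^2) - u)"
    using xi_weight_decay by metis
  have integrable: "set_integrable lborel {0<..} (\<lambda>u. of_real (xi_weight lam u) * of_real u ^ m :: complex)" for m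
  proof (rule set_integrable_exp_decay)
    show "continuous_on {0<..} (\<lambda>u. of_real (xi_weight lam u) * of_real u ^ m :: complex)"
      by (intro continuous_intros)
    show "norm (of_real (xi_weight lam u) * of_real u ^ m :: complex) \<le> (C * fact m * exp 2) * exp (- u)" if "u > 0" for u
    proof -
      \<comment> \<open>A single term of the exponential series is at most its sum.\<close>
      have "u ^ m / fact m \<le> exp u"
        using sum_le_suminf[OF summable_exp_generic[of u], of "{m}"] that by (simp add: exp_def field_simps)
      then have "u ^ m \<le> fact m * exp u"
        by (simp add: field_simps)
      then have "\<bar>xi_weight lam u\<bar> * u ^ m \<le> (C * exp (- (u^2) - u)) * (fact m * exp u)"
        using C that by (intro mult_mono) auto
      also have "\<dots> = C * fact m * exp ((- (u^2) - u) + u)"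
        by (simp only: exp_add mult_ac)
      \<comment> \<open>The bound on u^m has used up the factor exp(-u); a new one is drawn from the
        Gaussian through u <= u^2 + 2.\<close>
      also have "\<dots> \<le> C * fact m * exp (2 + - u)"
      proof -
        have "0 \<le> (u - 1 / 2)^2"
          by simp
        then show ?thesis
          using C(1) by (intro mult_left_mono exp_mono) (auto simp: power2_eq_square field_simps)
      qed
      also have "\<dots> = (C * fact m * exp 2) * exp (- u)"
        by (simp only: exp_add mult_ac)
      finally show ?thesis
        using that by (simp add: norm_mult norm_power)
    qed
  qed
  let ?S = "\<lambda>N u. \<Sum>n<N. sin_coeff n *\<^sub>R (z ^ n * of_real u ^ (n - 1))"
  have "(\<lambda>N. LINT u:{0<..}|lborel. of_real (xi_weight lam u) * ?S N u) \<longlonglongrightarrow> xi_integral lam z"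
    unfolding xi_integral_def set_lebesgue_integral_def
  proof (rule integral_dominated_convergence)
    show "(\<lambda>u. indicator {0<..} u *\<^sub>R (of_real (xi_weight lam u) * (sin (z * of_real u) / of_real u))) \<in> borel_measurable lborel"
      "(\<lambda>u. indicator {0<..} u *\<^sub>R (of_real (xi_weight lam u) * ?S N u)) \<in> borel_measurable lborel" for N
      by (simp, intro borel_measurable_continuous_on_indicator continuous_intros; simp)+
    show "integrable lborel (\<lambda>u. indicator {0<..} u *\<^sub>R (C * exp (2 * (norm z)^2) * exp (- u)))"
      using integrable_I0i_exp_mscale[of 1] unfolding set_integrable_def[symmetric] by simp
    show "AE u in lborel. (\<lambda>N. indicator {0<..} u *\<^sub>R (of_real (xi_weight lam u) * ?S N u))
        \<longlonglongrightarrow> indicator {0<..} u *\<^sub>R (of_real (xi_weight lam u) * (sin (z * of_real u) / of_real u))"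
    proof (intro AE_I2)
      fix u :: real
      show "(\<lambda>N. indicator {0<..} u *\<^sub>R (of_real (xi_weight lam u) * ?S N u))
        \<longlonglongrightarrow> indicator {0<..} u *\<^sub>R (of_real (xi_weight lam u) * (sin (z * of_real u) / of_real u))"
      proof (cases "u > 0")
        case True
        then show ?thesis
          using sin_power_series_sums[of u z] unfolding sums_def by (intro tendsto_intros)
      qed simp
    qed
    show "AE u in lborel. norm (indicator {0<..} u *\<^sub>R (of_real (xi_weight lam u) * ?S N u))
        \<le> indicator {0<..} u *\<^sub>R (C * exp (2 * (norm z)^2) * exp (- u))" for N
    proof (intro AE_I2)
      fix u :: real
      have "\<bar>xi_weight lam u\<bar> * norm (?S N u) \<le> C * exp (2 * (norm z)^2) * exp (- u)" if "u > 0"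
      proof -
        have "\<bar>xi_weight lam u\<bar> * norm (?S N u) \<le> \<bar>xi_weight lam u\<bar> * (norm z * exp (norm z * u))"
          by (intro mult_left_mono sin_power_series_bound that) auto
        also have "\<dots> \<le> C * exp (2 * (norm z)^2) * exp (- u)"
          using C that by (intro xi_weight_exp_growth) auto
        finally show ?thesis .
      qed
      then show "norm (indicator {0<..} u *\<^sub>R (of_real (xi_weight lam u) * ?S N u))
          \<le> indicator {0<..} u *\<^sub>R (C * exp (2 * (norm z)^2) * exp (- u))"
        by (cases "u > 0") (simp_all add: norm_mult)
    qed
  qed
  moreover have "(LINT u:{0<..}|lborel. of_real (xi_weight lam u) * ?S N u) = (\<Sum>n<N. c n * z ^ n)" for N
  proof -
    have "(LINT u:{0<..}|lborel. of_real (xi_weight lam u) * ?S N u)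
      = (LINT u:{0<..}|lborel. \<Sum>n<N. (of_real (sin_coeff n) * z ^ n) * (of_real (xi_weight lam u) * of_real u ^ (n - 1)))"
      by (simp add: sum_distrib_left scaleR_conv_of_real mult_ac)
    also have "\<dots> = (\<Sum>n<N. LINT u:{0<..}|lborel. (of_real (sin_coeff n) * z ^ n) * (of_real (xi_weight lam u) * of_real u ^ (n - 1)))"
      unfolding set_lebesgue_integral_def scaleR_sum_right
      by (intro Bochner_Integration.integral_sum)
         (use set_integrable_mult_right[OF integrable] in \<open>simp add: set_integrable_def\<close>)
    also have "\<dots> = (\<Sum>n<N. c n * z ^ n)"
      unfolding c_def set_integral_mult_right by (intro sum.cong) (auto simp: mult_ac)
    finally show ?thesis .
  qed
  ultimately show "(\<lambda>n. of_real (sin_coeff n) * (LINT u:{0<..}|lborel. of_real (xi_weight lam u) * of_real u ^ (n - 1)) * z ^ n)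
      sums xi_integral lam z"
    unfolding sums_def c_def by simp
qed

lemma xi_integral_holomorphic: "xi_integral lam holomorphic_on UNIV"
proof -
  obtain c where c: "\<And>z. (\<lambda>n. c n * z ^ n) sums xi_integral lam z"
    using xi_integral_power_series by metis
  have "DERIV (\<lambda>z. \<Sum>n. c n * z ^ n) z :> (\<Sum>n. diffs c n * z ^ n)" for z
    by (rule termdiffs_strong_converges_everywhere) (use c in \<open>auto simp: sums_iff\<close>)
  moreover have "(\<lambda>z. \<Sum>n. c n * z ^ n) = xi_integral lam"
    using c by (auto simp: sums_iff)
  ultimately show ?thesis
    by (auto simp: holomorphic_on_def field_differentiable_def intro: has_field_derivative_at_within)
qed

section \<open>Positivity on the positive real axis for \<open>lam \<le> 0\<close>\<close>

text \<open>This is the decrease of g(u)/u. The Gaussian factor contributes 2 lam u^2 Phi(u), which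
  has the right sign for \<open>lam \<le> 0\<close>; the rest is
  \<open>Phi_deriv_less\<close>.\<close>

lemma xi_weight_deriv_less:
  assumes "lam \<le> 0" "u > 0"
  shows "u * xi_weight_deriv lam u < xi_weight lam u"
proof -
  have "lam * (2 * u^2 * Phi u) \<le> 0"
    using assms Phi_pos[of u] by (intro mult_nonpos_nonneg) auto
  then have "u * (2 * lam * u * Phi u + Phi_deriv u) < Phi u"
    using Phi_deriv_less[OF assms(2)] by (simp add: algebra_simps power2_eq_square)
  then have "exp (lam * u^2) * (u * (2 * lam * u * Phi u + Phi_deriv u)) < exp (lam * u^2) * Phi u"
    by (rule mult_strict_left_mono) simp
  then show ?thesis
    by (simp add: xi_weight_def xi_weight_deriv_def mult_ac)
qed

text \<open>Gives (1 - cos tu)/t a factor u^2 near 0, which cancels the u^2 in the denominator of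
  the derivative of g(u)/u.\<close>

lemma one_minus_cos_le: "1 - cos x \<le> x^2 / 2" for x :: real
proof -
  have "(sin (x / 2))^2 \<le> (x / 2)^2"
    using abs_sin_x_le_abs_x[of "x / 2"] by (simp only: abs_le_square_iff)
  then show ?thesis
    using cos_double_sin[of "x / 2"] by (simp add: power2_eq_square)
qed

text \<open>
  Integrating by parts with the nonnegative primitive $(1 - \cos tu)/t$ of $\sin tu$ leaves an
  integrand of constant sign, because $g(u)/u$ is decreasing for the weight $g$.
\<close>
lemma LINT_xi_weight_sin_pos:
  assumes lam: "lam \<le> 0" and t: "t > 0"
  shows "(LINT u:{0<..}|lborel. xi_weight lam u * (sin (t * u) / u)) > 0"
proof -
  \<comment> \<open>\<open>P\<close> is minus (1 - cos tu)/t times the derivative of g(u)/u.\<close>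
  define P where "P u = (1 - cos (t * u)) / t * ((xi_weight lam u - u * xi_weight_deriv lam u) / u^2)" for u
  obtain C where C: "C > 0" "\<And>u. u \<ge> 0 \<Longrightarrow> \<bar>xi_weight lam u\<bar> \<le> C * exp (- u)"
    "\<And>u. u \<ge> 0 \<Longrightarrow> u * \<bar>xi_weight_deriv lam u\<bar> \<le> C * exp (- u)"
    using xi_weight_exp_decay by metis
  have cont_P: "continuous_on {0<..} P"
    unfolding P_def using t by (intro continuous_intros) auto
  have P_nonneg: "P u \<ge> 0" if "u > 0" for u
    unfolding P_def using xi_weight_deriv_less[OF lam that] t by (intro mult_nonneg_nonneg) auto
  have int_P: "set_integrable lborel {0<..} P"
  proof (rule set_integrable_exp_decay[OF cont_P])
    fix u :: real
    assume u: "u > 0"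
    have "(1 - cos (t * u)) / t \<le> t * u^2 / 2"
      using one_minus_cos_le[of "t * u"] t by (simp add: field_simps power2_eq_square)
    moreover have "xi_weight lam u - u * xi_weight_deriv lam u \<le> 2 * C * exp (- u)"
      using C(2)[of u] C(3)[of u] u abs_ge_minus_self[of "u * xi_weight_deriv lam u"]
      by (simp add: abs_mult)
    then have "(xi_weight lam u - u * xi_weight_deriv lam u) / u^2 \<le> 2 * C * exp (- u) / u^2"
      by (rule divide_right_mono) simp
    ultimately have "P u \<le> (t * u^2 / 2) * (2 * C * exp (- u) / u^2)"
      unfolding P_def using xi_weight_deriv_less[OF lam u] t by (intro mult_mono) auto
    also have "\<dots> = t * C * exp (- u)"
      using u by simp
    finally show "norm (P u) \<le> t * C * exp (- u)"
      using P_nonneg[OF u] by simp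
  qed
  have "(LINT u:{0<..}|lborel. xi_weight lam u * (sin (t * u) / u) - P u) = 0 - 0"
  proof (rule LINT_FTC_0_infinity)
    let ?F = "\<lambda>u. (1 - cos (t * u)) / t * (xi_weight lam u / u)"
    show "(?F has_real_derivative xi_weight lam u * (sin (t * u) / u) - P u) (at u)" if "u > 0" for u
    proof -
      have "((\<lambda>u. (1 - cos (t * u)) / t) has_real_derivative sin (t * u)) (at u)"
        using t by (auto intro!: derivative_eq_intros)
      moreover have "((\<lambda>u. xi_weight lam u / u) has_real_derivative
          (xi_weight_deriv lam u * u - xi_weight lam u * 1) / (u * u)) (at u)"
        using that by (intro DERIV_divide xi_weight_has_real_derivative DERIV_ident) auto
      ultimately have "(?F has_real_derivative sin (t * u) * (xi_weight lam u / u)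
          + (xi_weight_deriv lam u * u - xi_weight lam u * 1) / (u * u) * ((1 - cos (t * u)) / t)) (at u)"
        by (rule DERIV_mult)
      moreover have "(xi_weight_deriv lam u * u - xi_weight lam u * 1) / (u * u) * ((1 - cos (t * u)) / t) = - P u"
        unfolding P_def power2_eq_square minus_mult_right minus_divide_left by (simp add: mult_ac)
      ultimately show ?thesis
        by (simp add: mult_ac)
    qed
    show "continuous_on {0<..} (\<lambda>u. xi_weight lam u * (sin (t * u) / u) - P u)"
      by (intro continuous_intros cont_P) auto
    show "set_integrable lborel {0<..} (\<lambda>u. xi_weight lam u * (sin (t * u) / u) - P u)"
      by (intro set_integral_diff set_integrable_xi_weight_sin int_P)
    \<comment> \<open>The 1/u is grouped with the cosine, since g(u)/u alone blows up at 0.\<close>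
    have "((\<lambda>u. (1 - cos (t * u)) / (t * u)) \<longlongrightarrow> 0) (at_right 0)"
      using t by real_asymp
    from tendsto_mult[OF this xi_weight_at_right_0] show "(?F \<longlongrightarrow> 0) (at_right 0)"
      by (simp add: mult_ac)
    have "((\<lambda>u. (1 - cos (t * u)) / (t * u)) \<longlongrightarrow> 0) at_top"
    proof (rule Lim_null_comparison)
      show "\<forall>\<^sub>F u in at_top. norm ((1 - cos (t * u)) / (t * u)) \<le> 2 / (t * u)"
        using eventually_gt_at_top[of 0]
      proof eventually_elim
        case (elim u)
        have "\<bar>1 - cos (t * u)\<bar> \<le> 2"
          using cos_ge_minus_one[of "t * u"] cos_le_one[of "t * u"] by linarith
        then show ?case
          using elim t by (simp add: divide_right_mono)
      qed
      show "((\<lambda>u. 2 / (t * u)) \<longlongrightarrow> 0) at_top"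
        using t by real_asymp
    qed
    from tendsto_mult[OF this xi_weight_tendsto_0] show "(?F \<longlongrightarrow> 0) at_top"
      by (simp add: mult_ac)
  qed
  then have eq: "(LINT u:{0<..}|lborel. xi_weight lam u * (sin (t * u) / u)) = (LINT u:{0<..}|lborel. P u)"
    unfolding set_integral_diff(2)[OF set_integrable_xi_weight_sin int_P] by linarith
  have ge: "(LINT u:{0<..}|lborel. P u) \<ge> 0"
    unfolding set_lebesgue_integral_def
    by (intro Bochner_Integration.integral_nonneg) (use P_nonneg in \<open>auto split: split_indicator\<close>)
  \<comment> \<open>A vanishing integral would force the nonnegative \<open>P\<close> to be 0 almost
    everywhere, but \<open>P\<close> is positive on (0, pi/t), where cos(tu) < 1.\<close>
  have "(LINT u:{0<..}|lborel. P u) \<noteq> 0"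
  proof
    assume "(LINT u:{0<..}|lborel. P u) = 0"
    then have "AE u in lborel. indicator {0<..} u *\<^sub>R P u = 0"
      using int_P P_nonneg unfolding set_lebesgue_integral_def set_integrable_def
      by (subst (asm) integral_nonneg_eq_0_iff_AE) (auto split: split_indicator)
    then have "AE u in lborel. u \<notin> {0<..<pi / t}"
    proof eventually_elim
      case (elim u)
      show ?case
      proof
        assume u: "u \<in> {0<..<pi / t}"
        then have "cos (t * u) < cos 0"
          using t by (intro cos_monotone_0_pi) (auto simp: field_simps)
        then have "P u > 0"
          unfolding P_def using u t xi_weight_deriv_less[OF lam, of u] by (intro mult_pos_pos divide_pos_pos) auto
        then show False
          using elim u by simp
      qed
    qed
    then have "{0<..<pi / t} \<in> null_sets lborel"
      by (subst (asm) AE_iff_null_sets[symmetric]) auto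
    then show False
      using t by (simp add: null_sets_def)
  qed
  with ge eq show ?thesis
    by simp
qed

section \<open>Zeros on the real axis and off it\<close>

lemma Xi_m1_zeros_infinite: "infinite {z. Xi_m1 lam z = 0}"
proof -
  obtain C where C: "C > 0" "\<And>z. norm (xi_integral lam z) \<le> C * exp (2 * (norm z)^2)"
    using xi_integral_growth by metis
  have "infinite {z. xi_integral lam z = 0}"
  proof (rule infinite_zeros_if_odd_limit)
    show "xi_integral lam holomorphic_on UNIV"
      by (rule xi_integral_holomorphic)
    show "xi_integral lam (- z) = - xi_integral lam z" for z
      by (rule xi_integral_minus)
    show "xi_integral lam 0 = 0"
      using xi_integral_minus[of lam 0] by simp
    show "norm (xi_integral lam z) \<le> exp (ln C + 2 * (norm z)^2)" for z
      using C by (simp add: exp_add)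
    show "((\<lambda>t. xi_integral lam (of_real t)) \<longlongrightarrow> of_real (pi / 2 * Phi 0)) at_top"
      unfolding xi_integral_of_real by (intro tendsto_of_real LINT_xi_weight_sin_tendsto)
    show "complex_of_real (pi / 2 * Phi 0) \<noteq> 0"
      using Phi_pos[of 0] by simp
  qed simp
  then show ?thesis
    by (simp add: Xi_m1_conv_xi_integral)
qed

lemma Xi_m1_holomorphic: "Xi_m1 lam holomorphic_on UNIV"
  unfolding Xi_m1_conv_xi_integral[abs_def] by (intro holomorphic_intros xi_integral_holomorphic)

lemma Xi_m1_minus: "Xi_m1 lam (- z) = - Xi_m1 lam z"
  by (simp add: Xi_m1_conv_xi_integral xi_integral_minus)

lemma Xi_m1_tendsto: "((\<lambda>t::real. Xi_m1 lam (of_real t)) \<longlongrightarrow> of_real A0) at_top"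
proof -
  have "((\<lambda>t. 2 * complex_of_real (LINT u:{0<..}|lborel. xi_weight lam u * (sin (t * u) / u)))
      \<longlongrightarrow> 2 * of_real (pi / 2 * Phi 0)) at_top"
    by (intro tendsto_intros LINT_xi_weight_sin_tendsto)
  then show ?thesis
    by (simp add: Xi_m1_conv_xi_integral xi_integral_of_real A0_def)
qed

lemma A0_pos: "A0 > 0"
  by (simp add: A0_def Phi_pos)

lemma Xi_m1_real_zeros_finite: "finite {t::real. Xi_m1 lam (of_real t) = 0}"
proof -
  have "\<forall>\<^sub>F t in at_top. Xi_m1 lam (of_real t) \<noteq> 0"
    using Xi_m1_tendsto A0_pos by (intro tendsto_imp_eventually_ne[of _ "of_real A0"]) auto
  then obtain T where T: "\<And>t. t \<ge> T \<Longrightarrow> Xi_m1 lam (of_real t) \<noteq> 0"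
    by (auto simp: eventually_at_top_linorder)
  have "finite {z \<in> cball 0 \<bar>T\<bar>. Xi_m1 lam z = 0}"
  proof (rule holomorphic_compact_finite_zeros)
    \<comment> \<open>A constant odd function is 0, whereas the value at \<open>T\<close> is
      not.\<close>
    show "\<not> Xi_m1 lam constant_on UNIV"
    proof
      assume "Xi_m1 lam constant_on UNIV"
      then have "Xi_m1 lam (of_real T) = Xi_m1 lam (- of_real T)"
        unfolding constant_on_def by (metis UNIV_I)
      then show False
        using T[of T] by (simp add: Xi_m1_minus)
    qed
  qed (use Xi_m1_holomorphic in auto)
  moreover have "of_real ` {t::real. Xi_m1 lam (of_real t) = 0} \<subseteq> {z \<in> cball 0 \<bar>T\<bar>. Xi_m1 lam z = 0}"
  proof clarsimp
    fix t :: real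
    assume t: "Xi_m1 lam (of_real t) = 0"
    then have "Xi_m1 lam (of_real (- t)) = 0"
      by (simp add: Xi_m1_minus)
    then have "\<not> t \<ge> T" "\<not> - t \<ge> T"
      using t T by blast+
    then show "\<bar>t\<bar> \<le> \<bar>T\<bar>"
      by linarith
  qed
  ultimately have "finite ((of_real :: real \<Rightarrow> complex) ` {t. Xi_m1 lam (of_real t) = 0})"
    by (rule finite_subset[rotated])
  then show ?thesis
    by (rule finite_imageD) (simp add: inj_on_def)
qed

lemma Xi_m1_nonreal_zeros_infinite: "infinite {z. z \<notin> \<real> \<and> Xi_m1 lam z = 0}"
proof
  assume "finite {z. z \<notin> \<real> \<and> Xi_m1 lam z = 0}"
  then have "finite ({z. z \<notin> \<real> \<and> Xi_m1 lam z = 0} \<union> of_real ` {t::real. Xi_m1 lam (of_real t) = 0})"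
    using Xi_m1_real_zeros_finite by simp
  then have "finite {z. Xi_m1 lam z = 0}"
    by (rule finite_subset[rotated]) (auto elim: Reals_cases)
  then show False
    using Xi_m1_zeros_infinite by blast
qed

lemma Xi_m1_zero: "Xi_m1 lam 0 = 0"
  using Xi_m1_minus[of lam 0] by simp

lemma Xi_m1_real_zeros_nonpos:
  assumes "lam \<le> 0"
  shows "{t::real. Xi_m1 lam (of_real t) = 0} = {0}"
proof -
  have pos: "Xi_m1 lam (of_real t) \<noteq> 0" if "t > 0" for t :: real
    using LINT_xi_weight_sin_pos[OF assms that] by (simp add: Xi_m1_conv_xi_integral xi_integral_of_real)
  have "Xi_m1 lam (of_real t) \<noteq> 0" if "t < 0" for t :: real
    using pos[of "- t"] that by (simp add: Xi_m1_minus)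
  with pos show ?thesis
    using Xi_m1_zero[of lam] by (auto simp: less_linear) (metis not_less_iff_gr_or_eq)
qed

theorem theorem2p1:
  shows "(\<forall>lam::real. Xi_m1 lam holomorphic_on UNIV)
    \<and> (\<forall>lam::real. ((\<lambda>t::real. Xi_m1 lam (of_real t)) \<longlongrightarrow> of_real A0) at_top)
    \<and> A0 \<noteq> 0
    \<and> \<bar>A0 - 2.80668\<bar> \<le> 0.000005
    \<and> A0 = pi / 2 * (4 * deriv (deriv theta) 1 + 6 * deriv theta 1)
    \<and> (\<forall>lam::real. finite {t::real. Xi_m1 lam (of_real t) = 0}
                  \<and> infinite {z::complex. z \<notin> \<real> \<and> Xi_m1 lam z = 0}
                  \<and> Xi_m1 lam 0 = 0)
    \<and> (\<forall>lam::real. lam \<le> 0 \<longrightarrow> {t::real. Xi_m1 lam (of_real t) = 0} = {0})"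
  using Xi_m1_holomorphic Xi_m1_tendsto A0_pos A0_approx A0_conv_theta Xi_m1_real_zeros_finite
    Xi_m1_nonreal_zeros_infinite Xi_m1_zero Xi_m1_real_zeros_nonpos
  by simp

end
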